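(* Let $m\in\mathbb{N}$, let $\gamma$ be the standard Gaussian measure on $\mathbb{R}^m$, and let $g\in L^2(\mathbb{R}^m,\gamma)$ be a convex function. Then the minimizer of \[ \min_{u\in H^1_\gamma(\mathbb{R}^m)} \int_{\mathbb{R}^m}\frac{|\nabla u|^2}{2}\,d\gamma+\frac12\int_{\mathbb{R}^m}|u-g|^2\,d\gamma \] is convex.
   Context: $\gamma$ has density $(2\pi)^{-m/2}e^{-|x|^2/2}$. $H^1_\gamma(\mathbb{R}^m)$ denotes the Gaussian Sobolev space, i.e. the domain of the closure in $L^2(\mathbb{R}^m,\gamma)$ of the gradient operator defined on smooth functions. *)

theory Defs
  imports "HOL-Analysis.Analysis"
begin

definition gauss_dens :: "real ^ 'n \<Rightarrow> real" where
  "gauss_dens x = (2 * pi) powr (- real CARD('n) / 2) * exp (- (norm x)\<^sup>2 / 2)"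

definition gauss :: "(real ^ 'n) measure" where
  "gauss = density lborel (\<lambda>x. ennreal (gauss_dens x))"

fun dderiv :: "(real ^ 'n \<Rightarrow> real) \<Rightarrow> (real ^ 'n) list \<Rightarrow> real ^ 'n \<Rightarrow> real" where
  "dderiv f [] = f"
| "dderiv f (v # vs) = (\<lambda>x. frechet_derivative (dderiv f vs) (at x) v)"

definition smooth_fun :: "(real ^ 'n \<Rightarrow> real) \<Rightarrow> bool" where
  "smooth_fun f \<longleftrightarrow> (\<forall>vs x. dderiv f vs differentiable (at x))"

definition smooth_cpt :: "(real ^ 'n \<Rightarrow> real) \<Rightarrow> bool" where
  "smooth_cpt f \<longleftrightarrow> smooth_fun f \<and> compact (closure {x. f x \<noteq> 0})"

definition grad :: "(real ^ 'n \<Rightarrow> real) \<Rightarrow> real ^ 'n \<Rightarrow> real ^ 'n" where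
  "grad f x = (\<chi> i. frechet_derivative f (at x) (axis i 1))"

text \<open>u belongs to H^1_gamma with (closed) gradient G: the pair (u,G) lies in the
  L^2(gamma)-closure of the graph of the gradient on smooth compactly supported functions.\<close>
definition H1_gauss :: "(real ^ 'n \<Rightarrow> real) \<Rightarrow> (real ^ 'n \<Rightarrow> real ^ 'n) \<Rightarrow> bool" where
  "H1_gauss u G \<longleftrightarrow>
     u \<in> borel_measurable gauss \<and> integrable gauss (\<lambda>x. (u x)\<^sup>2) \<and>
     G \<in> borel_measurable gauss \<and> integrable gauss (\<lambda>x. (norm (G x))\<^sup>2) \<and>
     (\<exists>\<phi>. (\<forall>k. smooth_cpt (\<phi> k)) \<and>
        (\<lambda>k. \<integral>x. (\<phi> k x - u x)\<^sup>2 \<partial>gauss) \<longlonglongrightarrow> 0 \<and>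
        (\<lambda>k. \<integral>x. (norm (grad (\<phi> k) x - G x))\<^sup>2 \<partial>gauss) \<longlonglongrightarrow> 0)"

definition energy :: "(real ^ 'n \<Rightarrow> real) \<Rightarrow> (real ^ 'n \<Rightarrow> real) \<Rightarrow> (real ^ 'n \<Rightarrow> real ^ 'n) \<Rightarrow> real" where
  "energy g u G = (\<integral>x. (norm (G x))\<^sup>2 / 2 \<partial>gauss) + 1/2 * (\<integral>x. (u x - g x)\<^sup>2 \<partial>gauss)"

definition is_minimizer :: "(real ^ 'n \<Rightarrow> real) \<Rightarrow> (real ^ 'n \<Rightarrow> real) \<Rightarrow> (real ^ 'n \<Rightarrow> real ^ 'n) \<Rightarrow> bool" where
  "is_minimizer g u G \<longleftrightarrow> H1_gauss u G \<and> (\<forall>v H. H1_gauss v H \<longrightarrow> energy g u G \<le> energy g v H)"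

end

theory Submission
  imports Defs "HOL-Probability.Probability"
begin

text \<open>The Euler-Lagrange equation of the functional is \<open>u - L u = g\<close> with \<open>L\<close> the Ornstein-Uhlenbeck
  operator, so the minimizer is \<open>u x = \<integral>\<^sub>0\<^sup>\<infinity> exp (- s) P\<^sub>s g x ds\<close> with \<open>P\<^sub>s\<close> the Mehler semigroup. With
  \<open>exp (- s) = cos t\<close> this reads
  \<open>u x = \<integral>\<^sub>0\<^sup>\<pi>\<^sup>/\<^sup>2 sin t \<integral> g (cos t x + sin t y) d\<gamma>(y) dt\<close>,
  an average of convex functions of \<open>x\<close>. It satisfies the weak equation because \<open>\<gamma> \<otimes> \<gamma>\<close> is invariant
  under rotations; it lies in the Sobolev space because its gradient is a bounded operator of
  \<open>g\<close> in \<open>L\<^sup>2(\<gamma>)\<close> and test functions are dense. By the weak equation the energy of any competitor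
  exceeds that of \<open>u\<close> by half its squared Sobolev distance to \<open>u\<close>.\<close>

section \<open>The standard Gaussian measure\<close>

text \<open>The weight \<open>sin t\<close> is what makes the gradient bounded. Differentiating
  \<open>g (cos t x + sin t y)\<close> in \<open>x\<close> gives a factor \<open>cos t\<close>, and
  moving that derivative onto the Gaussian in \<open>y\<close> costs \<open>1 / sin t\<close>; the
  weight cancels this singularity at \<open>t = 0\<close>, so the gradient becomes the average of
  \<open>g\<close> against \<open>cos t y\<close>, which is square integrable for the noise measure.
  Two obstacles shape the rest. Membership in the Sobolev space means being a limit of compactly
  supported functions, but averages of test functions need not have compact support:
  \<open>y\<close> is unbounded, and near \<open>t = pi / 2\<close> the point
  \<open>cos t x + sin t y\<close> hardly depends on \<open>x\<close>. And \<open>L\<^sup>2\<close>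
  theory controls the averaging integral only for almost every \<open>x\<close>, while convexity is
  an inequality at every point; convexity of \<open>g\<close> itself has to supply integrability at
  the remaining points.\<close>

lemma sets_gauss [measurable_cong, simp]: "sets gauss = sets borel"
  by (simp add: gauss_def)

lemma space_gauss [simp]: "space gauss = UNIV"
  by (simp add: gauss_def)

lemma gauss_dens_pos: "0 < gauss_dens x"
  by (simp add: gauss_dens_def)

lemma gauss_dens_nonneg [simp]: "0 \<le> gauss_dens x"
  using gauss_dens_pos[of x] by simp

lemma continuous_on_gauss_dens [continuous_intros]: "continuous_on S gauss_dens"
  unfolding gauss_dens_def by (intro continuous_intros) auto

lemma gauss_dens_measurable [measurable]: "gauss_dens \<in> borel_measurable borel"
  by (intro borel_measurable_continuous_onI continuous_intros)

text \<open>The factorization over coordinates reduces normalization and moments to one-dimensional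
  normal densities by Tonelli.\<close>

lemma gauss_dens_eq_prod: "gauss_dens (x :: real ^ 'n) = (\<Prod>b\<in>Basis. std_normal_density (x \<bullet> b))"
proof -
  have "(2 * pi) powr (- real CARD('n) / 2) = ((2 * pi) powr (- 1 / 2)) powr (real CARD('n))"
    by (simp add: powr_powr)
  also have "\<dots> = ((2 * pi) powr (- 1 / 2)) ^ CARD('n)"
    by (rule powr_realpow) simp
  also have "(2 * pi) powr (- 1 / 2) = 1 / sqrt (2 * pi)"
    by (simp add: powr_minus_divide powr_half_sqrt)
  finally have 1: "(2 * pi) powr (- real CARD('n) / 2) = (\<Prod>b\<in>(Basis :: (real ^ 'n) set). 1 / sqrt (2 * pi))"
    by simp
  have "(norm x)\<^sup>2 = (\<Sum>b\<in>Basis. (x \<bullet> b)\<^sup>2)"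
    unfolding power2_norm_eq_inner by (subst euclidean_inner) (simp add: power2_eq_square)
  then have 2: "exp (- (norm x)\<^sup>2 / 2) = (\<Prod>b\<in>Basis. exp (- (x \<bullet> b)\<^sup>2 / 2))"
    by (simp add: exp_sum[symmetric] sum_negf sum_divide_distrib)
  show ?thesis
    unfolding gauss_dens_def 1 2 std_normal_density_def prod.distrib ..
qed

lemma nn_integral_gauss:
  assumes "f \<in> borel_measurable borel"
  shows "(\<integral>\<^sup>+x. f x \<partial>gauss) = (\<integral>\<^sup>+x. ennreal (gauss_dens x) * f x \<partial>lborel)"
  unfolding gauss_def using assms by (subst nn_integral_density) auto

lemma nn_integral_std_normal: "(\<integral>\<^sup>+x. ennreal (std_normal_density x) \<partial>lborel) = 1"
  by (subst nn_integral_eq_integral) auto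

lemma prob_space_gauss: "prob_space (gauss :: (real ^ 'n) measure)"
proof
  have "emeasure gauss (space (gauss :: (real ^ 'n) measure)) = (\<integral>\<^sup>+x. 1 \<partial>(gauss :: (real ^ 'n) measure))"
    by simp
  also have "\<dots> = (\<integral>\<^sup>+x. (\<Prod>b\<in>Basis. ennreal (std_normal_density (x \<bullet> b))) \<partial>(lborel :: (real ^ 'n) measure))"
    by (subst nn_integral_gauss) (auto simp: gauss_dens_eq_prod prod_ennreal)
  also have "\<dots> = (\<Prod>b\<in>(Basis :: (real ^ 'n) set). \<integral>\<^sup>+x. ennreal (std_normal_density x) \<partial>lborel)"
    by (rule nn_integral_lborel_prod) auto
  also have "\<dots> = 1"
    by (simp add: nn_integral_std_normal)
  finally show "emeasure gauss (space (gauss :: (real ^ 'n) measure)) = 1" .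
qed

interpretation gauss: prob_space gauss by (rule prob_space_gauss)

text \<open>This moment is what makes the weight \<open>cos t y\<close> of the gradient formula
  square integrable.\<close>

lemma gauss_second_moment_finite: "(\<integral>\<^sup>+x. ennreal ((norm x)\<^sup>2) \<partial>(gauss :: (real ^ 'n) measure)) < \<infinity>"
proof -
  have coord: "(\<integral>\<^sup>+x. ennreal ((x \<bullet> b)\<^sup>2) \<partial>(gauss :: (real ^ 'n) measure)) < \<infinity>" if "b \<in> Basis" for b
  proof -
    \<comment> \<open>The square is attached to the coordinate \<open>b\<close> only, so the
      integrand stays a product and splits into one-dimensional integrals.\<close>
    define f where "f c y = (if c = b then std_normal_density y * y\<^sup>2 else std_normal_density y)" for c :: "real ^ 'n" and y
    have "gauss_dens x * (x \<bullet> b)\<^sup>2 = (\<Prod>c\<in>Basis. f c (x \<bullet> c))" for x :: "real ^ 'n"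
      using that unfolding gauss_dens_eq_prod f_def
      by (subst (1 2) prod.remove[OF finite_Basis that]) (auto simp: mult.assoc mult.commute mult.left_commute intro!: prod.cong)
    then have "(\<integral>\<^sup>+x. ennreal ((x \<bullet> b)\<^sup>2) \<partial>(gauss :: (real ^ 'n) measure))
        = (\<integral>\<^sup>+x. (\<Prod>c\<in>Basis. ennreal (f c (x \<bullet> c))) \<partial>(lborel :: (real ^ 'n) measure))"
      by (subst nn_integral_gauss) (auto simp: ennreal_mult'[symmetric] prod_ennreal f_def)
    also have "\<dots> = (\<Prod>c\<in>(Basis :: (real ^ 'n) set). \<integral>\<^sup>+x. ennreal (f c x) \<partial>lborel)"
      by (rule nn_integral_lborel_prod) (auto simp: f_def)
    also have "\<dots> < \<infinity>"
    proof -
      have "(\<integral>\<^sup>+x. ennreal (f c x) \<partial>lborel) < \<infinity>" for c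
        using integrable_std_normal_moment[of 2]
        by (cases "c = b") (auto simp: f_def nn_integral_std_normal nn_integral_eq_integral)
      then have "(\<Prod>c\<in>A. \<integral>\<^sup>+x. ennreal (f c x) \<partial>lborel) < \<infinity>" for A
        by (induction A rule: infinite_finite_induct) (auto simp: ennreal_mult_less_top)
      then show ?thesis .
    qed
    finally show ?thesis .
  qed
  have "(norm x)\<^sup>2 = (\<Sum>b\<in>Basis. (x \<bullet> b)\<^sup>2)" for x :: "real ^ 'n"
    unfolding power2_norm_eq_inner by (subst euclidean_inner) (simp add: power2_eq_square)
  then have "(\<integral>\<^sup>+x. ennreal ((norm x)\<^sup>2) \<partial>(gauss :: (real ^ 'n) measure)) =
      (\<Sum>b\<in>Basis. \<integral>\<^sup>+x. ennreal ((x \<bullet> b)\<^sup>2) \<partial>(gauss :: (real ^ 'n) measure))"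
    by (simp only: sum_ennreal[OF zero_le_power2, symmetric]) (subst nn_integral_sum; simp)
  then show ?thesis
    using coord by (simp add: less_top)
qed

lemma integrable_gauss_norm_power2: "integrable gauss (\<lambda>x. (norm x)\<^sup>2)"
  using gauss_second_moment_finite by (intro integrableI_bounded) auto

section \<open>Square integrable functions\<close>

text \<open>Values lie in any Euclidean space, so that functions and their gradients share one set
  of \<open>L\<^sup>2\<close> estimates.\<close>

definition square_integrable :: "'a measure \<Rightarrow> ('a \<Rightarrow> 'b :: euclidean_space) \<Rightarrow> bool" where
  "square_integrable M f \<longleftrightarrow> f \<in> borel_measurable M \<and> integrable M (\<lambda>x. (norm (f x))\<^sup>2)"

lemma square_integrable_measurable [measurable_dest]:
  "square_integrable M f \<Longrightarrow> f \<in> borel_measurable M"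
  by (simp add: square_integrable_def)

lemma square_integrable_norm_power2:
  "square_integrable M f \<Longrightarrow> integrable M (\<lambda>x. (norm (f x))\<^sup>2)"
  by (simp add: square_integrable_def)

lemma square_integrable_real_power2:
  fixes f :: "'a \<Rightarrow> real"
  shows "square_integrable M f \<Longrightarrow> integrable M (\<lambda>x. (f x)\<^sup>2)"
  by (simp add: square_integrable_def)

lemma norm_add_power2_le: "(norm (x + y :: 'b :: real_inner))\<^sup>2 \<le> 2 * (norm x)\<^sup>2 + 2 * (norm y)\<^sup>2"
proof -
  have "(norm (x + y))\<^sup>2 + (norm (x - y))\<^sup>2 = 2 * (norm x)\<^sup>2 + 2 * (norm y)\<^sup>2"
    by (simp add: power2_norm_eq_inner algebra_simps inner_commute)
  then show ?thesis
    by (smt (verit) zero_le_power2)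
qed

lemma square_integrable_add:
  assumes "square_integrable M f" "square_integrable M g"
  shows "square_integrable M (\<lambda>x. f x + g x)"
  unfolding square_integrable_def
proof
  note [measurable] = assms[THEN square_integrable_measurable]
  show "(\<lambda>x. f x + g x) \<in> borel_measurable M" by measurable
  show "integrable M (\<lambda>x. (norm (f x + g x))\<^sup>2)"
    by (rule Bochner_Integration.integrable_bound[where f = "\<lambda>x. 2 * (norm (f x))\<^sup>2 + 2 * (norm (g x))\<^sup>2"])
      (use assms in \<open>auto intro!: AE_I2 norm_add_power2_le square_integrable_norm_power2\<close>)
qed

lemma square_integrable_scaleR:
  "square_integrable M f \<Longrightarrow> square_integrable M (\<lambda>x. c *\<^sub>R f x)"
  by (auto simp: square_integrable_def power_mult_distrib)

lemma square_integrable_cmult: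
  fixes f :: "'a \<Rightarrow> real"
  shows "square_integrable M f \<Longrightarrow> square_integrable M (\<lambda>x. c * f x)"
  using square_integrable_scaleR[of M f c] by simp

lemma square_integrable_diff:
  assumes "square_integrable M f" "square_integrable M g"
  shows "square_integrable M (\<lambda>x. f x - g x)"
  using square_integrable_add[OF assms(1) square_integrable_scaleR[OF assms(2), of "-1"]] by simp

lemma square_integrable_bound:
  assumes "square_integrable M f" "g \<in> borel_measurable M" "AE x in M. norm (g x) \<le> norm (f x)"
  shows "square_integrable M g"
  unfolding square_integrable_def
proof
  show "integrable M (\<lambda>x. (norm (g x))\<^sup>2)"
    by (rule Bochner_Integration.integrable_bound[OF square_integrable_norm_power2[OF assms(1)]])
      (use assms in \<open>auto intro!: power_mono\<close>)
qed (fact assms(2))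

lemma square_integrable_inner:
  assumes "square_integrable M f" "square_integrable M g"
  shows "integrable M (\<lambda>x. f x \<bullet> g x)"
proof (rule Bochner_Integration.integrable_bound[where f = "\<lambda>x. (norm (f x))\<^sup>2 + (norm (g x))\<^sup>2"])
  note [measurable] = assms[THEN square_integrable_measurable]
  show "(\<lambda>x. f x \<bullet> g x) \<in> borel_measurable M" by measurable
  have "\<bar>a \<bullet> b\<bar> \<le> (norm a)\<^sup>2 + (norm b)\<^sup>2" for a b :: 'b
    using Cauchy_Schwarz_ineq2[of a b] sum_squares_bound[of "norm a" "norm b"]
      mult_nonneg_nonneg[OF norm_ge_zero[of a] norm_ge_zero[of b]] by linarith
  then show "AE x in M. norm (f x \<bullet> g x) \<le> norm ((norm (f x))\<^sup>2 + (norm (g x))\<^sup>2)"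
    by simp
qed (use assms in \<open>auto intro!: square_integrable_norm_power2\<close>)

lemma square_integrable_mult:
  fixes f g :: "'a \<Rightarrow> real"
  assumes "square_integrable M f" "square_integrable M g"
  shows "integrable M (\<lambda>x. f x * g x)"
  using square_integrable_inner[OF assms] by (simp add: mult.commute)

lemma Cauchy_Schwarz_integral:
  assumes f: "square_integrable M f" and g: "square_integrable M g"
  shows "(\<integral>x. f x \<bullet> g x \<partial>M)\<^sup>2 \<le> (\<integral>x. (norm (f x))\<^sup>2 \<partial>M) * (\<integral>x. (norm (g x))\<^sup>2 \<partial>M)"
proof -
  define A B C where "A = (\<integral>x. (norm (f x))\<^sup>2 \<partial>M)" and "B = (\<integral>x. f x \<bullet> g x \<partial>M)"
    and "C = (\<integral>x. (norm (g x))\<^sup>2 \<partial>M)"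
  have I: "integrable M (\<lambda>x. (norm (f x))\<^sup>2)" "integrable M (\<lambda>x. f x \<bullet> g x)" "integrable M (\<lambda>x. (norm (g x))\<^sup>2)"
    using f g by (auto intro: square_integrable_inner square_integrable_norm_power2)
  \<comment> \<open>Two free parameters instead of one avoid division, so the degenerate case
    \<open>A = 0\<close> only needs a different choice of them.\<close>
  have quad: "0 \<le> s\<^sup>2 * A + 2 * s * r * B + r\<^sup>2 * C" for s r
  proof -
    have "0 \<le> (\<integral>x. (norm (s *\<^sub>R f x + r *\<^sub>R g x))\<^sup>2 \<partial>M)"
      by simp
    also have "\<dots> = (\<integral>x. s\<^sup>2 * (norm (f x))\<^sup>2 + 2 * s * r * (f x \<bullet> g x) + r\<^sup>2 * (norm (g x))\<^sup>2 \<partial>M)"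
      by (intro Bochner_Integration.integral_cong refl)
        (simp add: power2_norm_eq_inner inner_commute algebra_simps power2_eq_square[of s] power2_eq_square[of r])
    also have "\<dots> = s\<^sup>2 * A + 2 * s * r * B + r\<^sup>2 * C"
      using I by (simp add: A_def B_def C_def)
    finally show ?thesis .
  qed
  have "0 \<le> A" by (simp add: A_def)
  show ?thesis
    unfolding A_def[symmetric] B_def[symmetric] C_def[symmetric]
  proof (cases "A = 0")
    case True
    \<comment> \<open>With \<open>A = 0\<close> the form is \<open>r * (2 * s * B + r * C)\<close>;
      taking \<open>r = B\<close> and \<open>s = - (C + 1)\<close> turns it into a negative multiple
      of the square of \<open>B\<close>.\<close>
    have "0 \<le> - ((C + 2) * B\<^sup>2)"
      using quad[of "- (C + 1)" B] by (simp add: True algebra_simps power2_eq_square)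
    moreover have "0 \<le> C" by (simp add: C_def)
    ultimately have "B\<^sup>2 \<le> 0"
      by (simp add: mult_le_0_iff)
    then show "B\<^sup>2 \<le> A * C" using True by simp
  next
    case False
    with \<open>0 \<le> A\<close> have "0 < A" by simp
    \<comment> \<open>For \<open>r = A\<close> the form is smallest at
      \<open>s = - B\<close>.\<close>
    have "0 \<le> A * (A * C - B\<^sup>2)"
      using quad[of "- B" A] by (simp add: algebra_simps power2_eq_square)
    with \<open>0 < A\<close> show "B\<^sup>2 \<le> A * C"
      by (simp add: zero_le_mult_iff)
  qed
qed

lemma integral_norm_add_power2_le:
  assumes "square_integrable M f" "square_integrable M g"
  shows "(\<integral>x. (norm (f x + g x))\<^sup>2 \<partial>M) \<le> 2 * (\<integral>x. (norm (f x))\<^sup>2 \<partial>M) + 2 * (\<integral>x. (norm (g x))\<^sup>2 \<partial>M)"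
proof -
  have "(\<integral>x. (norm (f x + g x))\<^sup>2 \<partial>M) \<le> (\<integral>x. 2 * (norm (f x))\<^sup>2 + 2 * (norm (g x))\<^sup>2 \<partial>M)"
    using assms by (intro integral_mono norm_add_power2_le square_integrable_norm_power2 square_integrable_add)
      (auto intro!: square_integrable_norm_power2)
  also have "\<dots> = 2 * (\<integral>x. (norm (f x))\<^sup>2 \<partial>M) + 2 * (\<integral>x. (norm (g x))\<^sup>2 \<partial>M)"
    using assms by (simp add: square_integrable_norm_power2)
  finally show ?thesis .
qed

text \<open>By Cauchy-Schwarz, pairing with a fixed \<open>L\<^sup>2\<close> function is continuous.
  This later carries the weak equation from test functions to the Sobolev space.\<close>

lemma tendsto_integral_inner_L2:
  assumes F: "\<And>k. square_integrable M (F k)" and f: "square_integrable M f" and h: "square_integrable M h"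
    and lim: "(\<lambda>k. \<integral>x. (norm (F k x - f x))\<^sup>2 \<partial>M) \<longlonglongrightarrow> 0"
  shows "(\<lambda>k. \<integral>x. h x \<bullet> F k x \<partial>M) \<longlonglongrightarrow> (\<integral>x. h x \<bullet> f x \<partial>M)"
proof -
  have bound: "\<bar>(\<integral>x. h x \<bullet> F k x \<partial>M) - (\<integral>x. h x \<bullet> f x \<partial>M)\<bar>
      \<le> sqrt ((\<integral>x. (norm (h x))\<^sup>2 \<partial>M) * (\<integral>x. (norm (F k x - f x))\<^sup>2 \<partial>M))" for k
  proof -
    have "(\<integral>x. h x \<bullet> F k x \<partial>M) - (\<integral>x. h x \<bullet> f x \<partial>M) = (\<integral>x. h x \<bullet> (F k x - f x) \<partial>M)"
      using F f h by (simp add: inner_diff_right square_integrable_inner)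
    then show ?thesis
      using Cauchy_Schwarz_integral[OF h square_integrable_diff[OF F[of k] f]]
      by (simp add: real_le_rsqrt)
  qed
  have lim': "(\<lambda>k. sqrt ((\<integral>x. (norm (h x))\<^sup>2 \<partial>M) * (\<integral>x. (norm (F k x - f x))\<^sup>2 \<partial>M))) \<longlonglongrightarrow> 0"
    using tendsto_real_sqrt[OF tendsto_mult[OF tendsto_const lim]] by simp
  have "(\<lambda>k. (\<integral>x. h x \<bullet> F k x \<partial>M) - (\<integral>x. h x \<bullet> f x \<partial>M)) \<longlonglongrightarrow> 0"
    by (rule Lim_null_comparison[OF always_eventually lim']) (simp only: real_norm_def bound simp_thms)
  then show ?thesis
    by (simp add: LIM_zero_iff)
qed

section \<open>Rotation invariance\<close>

text \<open>Up to an endpoint, the interval is the image of \<open>s \<ge> 0\<close> under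
  \<open>exp (- s) = cos t\<close>. The Jacobian \<open>sin t\<close> is left to the weights, since
  \<open>res\<close> and \<open>res_grad\<close> weight the angle differently.\<close>

definition angle :: "real measure" where
  "angle = density lborel (indicator {0..pi/2})"

lemma sets_angle [measurable_cong, simp]: "sets angle = sets borel"
  by (simp add: angle_def)

lemma space_angle [simp]: "space angle = UNIV"
  by (simp add: angle_def)

lemma AE_angle: "AE t in angle. 0 < t \<and> t < pi / 2"
proof -
  have "AE t in lborel. t \<noteq> 0 \<and> t \<noteq> (pi / 2 :: real)"
    using AE_lborel_singleton[of "0::real"] AE_lborel_singleton[of "pi / 2"] by eventually_elim simp
  then show ?thesis
    unfolding angle_def by (subst AE_density) (auto simp: indicator_def)
qed

lemma emeasure_angle: "emeasure angle UNIV = ennreal (pi / 2)"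
  by (simp add: angle_def emeasure_density)

lemma finite_measure_angle: "finite_measure angle"
  by standard (simp add: emeasure_angle)

interpretation angle: finite_measure angle by (rule finite_measure_angle)

abbreviation noise :: "(real \<times> (real ^ 'n)) measure" where
  "noise \<equiv> angle \<Otimes>\<^sub>M gauss"

interpretation angle_gauss: pair_sigma_finite angle gauss ..
interpretation gauss_angle: pair_sigma_finite gauss angle ..

lemma finite_measure_noise: "finite_measure noise"
  by (rule finite_measure_pair_measure) unfold_locales

interpretation noise: finite_measure noise by (rule finite_measure_noise)
interpretation gauss_noise: pair_sigma_finite gauss noise ..

lemma sigma_finite_measure_noise: "sigma_finite_measure noise"
  using finite_measure_noise by (rule finite_measure.sigma_finite_measure)

lemma finite_measure_gauss_noise: "finite_measure (gauss \<Otimes>\<^sub>M noise)"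
  by (rule finite_measure_pair_measure) unfold_locales

interpretation gauss_noise: finite_measure "gauss \<Otimes>\<^sub>M noise"
  by (rule finite_measure_gauss_noise)

text \<open>The angle is carried along unchanged, so the product measure is preserved as soon as
  each fixed rotation preserves the product of two Gaussians. The first component is the point at
  which \<open>g\<close> is averaged.\<close>

definition rot :: "(real ^ 'n) \<times> (real \<times> (real ^ 'n)) \<Rightarrow> (real ^ 'n) \<times> (real \<times> (real ^ 'n))" where
  "rot = (\<lambda>(x, t, y). (cos t *\<^sub>R x + sin t *\<^sub>R y, t, cos t *\<^sub>R y - sin t *\<^sub>R x))"

lemma nn_integral_lborel_translate:
  fixes c :: "'a :: euclidean_space"
  assumes [measurable]: "f \<in> borel_measurable borel"
  shows "(\<integral>\<^sup>+x. f (x + c) \<partial>lborel) = (\<integral>\<^sup>+x. f x \<partial>lborel)"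
  by (subst (2) lborel_distr_plus[of c, symmetric]) (simp add: nn_integral_distr add.commute)

lemma nn_integral_lborel_shear_snd:
  fixes f :: "'a :: euclidean_space \<Rightarrow> 'a \<Rightarrow> ennreal"
  assumes [measurable]: "case_prod f \<in> borel_measurable (borel \<Otimes>\<^sub>M borel)"
  shows "(\<integral>\<^sup>+x. \<integral>\<^sup>+y. f x (y + a *\<^sub>R x) \<partial>lborel \<partial>lborel) = (\<integral>\<^sup>+x. \<integral>\<^sup>+y. f x y \<partial>lborel \<partial>lborel)"
  by (intro nn_integral_cong nn_integral_lborel_translate) measurable

lemma nn_integral_lborel_shear_fst:
  fixes f :: "'a :: euclidean_space \<Rightarrow> 'a \<Rightarrow> ennreal"
  assumes [measurable]: "case_prod f \<in> borel_measurable (borel \<Otimes>\<^sub>M borel)"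
  shows "(\<integral>\<^sup>+x. \<integral>\<^sup>+y. f (x + a *\<^sub>R y) y \<partial>lborel \<partial>lborel) = (\<integral>\<^sup>+x. \<integral>\<^sup>+y. f x y \<partial>lborel \<partial>lborel)"
proof -
  have "(\<integral>\<^sup>+x. \<integral>\<^sup>+y. f (x + a *\<^sub>R y) y \<partial>lborel \<partial>lborel) = (\<integral>\<^sup>+y. \<integral>\<^sup>+x. f (x + a *\<^sub>R y) y \<partial>lborel \<partial>lborel)"
    by (subst lborel_pair.Fubini') (auto simp: case_prod_beta)
  also have "\<dots> = (\<integral>\<^sup>+y. \<integral>\<^sup>+x. f x y \<partial>lborel \<partial>lborel)"
    by (intro nn_integral_cong nn_integral_lborel_translate) measurable
  also have "\<dots> = (\<integral>\<^sup>+x. \<integral>\<^sup>+y. f x y \<partial>lborel \<partial>lborel)"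
    by (subst lborel_pair.Fubini') auto
  finally show ?thesis .
qed

text \<open>A plane rotation by \<open>t\<close> is the product of three shears with coefficients
  \<open>tan (t / 2)\<close>, \<open>- sin t\<close>, \<open>tan (t / 2)\<close>.\<close>
lemma nn_integral_lborel_rotate:
  fixes f :: "'a :: euclidean_space \<Rightarrow> 'a \<Rightarrow> ennreal"
  assumes f [measurable]: "case_prod f \<in> borel_measurable (borel \<Otimes>\<^sub>M borel)"
    and t: "cos (t / 2) \<noteq> 0"
  shows "(\<integral>\<^sup>+x. \<integral>\<^sup>+y. f (cos t *\<^sub>R x + sin t *\<^sub>R y) (cos t *\<^sub>R y - sin t *\<^sub>R x) \<partial>lborel \<partial>lborel)
    = (\<integral>\<^sup>+x. \<integral>\<^sup>+y. f x y \<partial>lborel \<partial>lborel)"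
proof -
  define a where "a = tan (t / 2)"
  have s: "sin t = 2 * sin (t / 2) * cos (t / 2)" using sin_double[of "t / 2"] by simp
  have c: "cos t = 1 - 2 * sin (t / 2) * sin (t / 2)"
    using cos_double_sin[of "t / 2"] by (simp add: power2_eq_square)
  have cs: "cos t = 1 - a * sin t"
    unfolding c s a_def tan_def using t by (simp add: field_simps)
  have "a * (1 + cos t) = 2 * a * (1 - (sin (t / 2))\<^sup>2)"
    unfolding c by (simp add: algebra_simps power2_eq_square)
  also have "1 - (sin (t / 2))\<^sup>2 = (cos (t / 2))\<^sup>2"
    by (simp add: cos_squared_eq)
  also have "2 * a * (cos (t / 2))\<^sup>2 = sin t"
    unfolding s a_def tan_def using t by (simp add: power2_eq_square)
  finally have sc: "sin t = a + a * cos t" by (simp add: algebra_simps)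
  have y: "cos t *\<^sub>R y - sin t *\<^sub>R x = y + (- sin t) *\<^sub>R (x + a *\<^sub>R y)" for x y :: 'a
    by (subst cs) (simp add: algebra_simps)
  have x: "cos t *\<^sub>R x + sin t *\<^sub>R y = (x + a *\<^sub>R y) + a *\<^sub>R (cos t *\<^sub>R y - sin t *\<^sub>R x)" for x y :: 'a
  proof -
    have "cos t *\<^sub>R x = x - (a * sin t) *\<^sub>R x" by (subst cs) (simp add: algebra_simps)
    moreover have "sin t *\<^sub>R y = a *\<^sub>R y + (a * cos t) *\<^sub>R y" by (subst sc) (simp add: algebra_simps)
    ultimately show ?thesis by (simp add: algebra_simps)
  qed
  define f1 where "f1 x y = f (x + a *\<^sub>R y) y" for x y
  have [measurable]: "case_prod f1 \<in> borel_measurable (borel \<Otimes>\<^sub>M borel)"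
    unfolding f1_def by measurable
  define f2 where "f2 x y = f1 x (y + (- sin t) *\<^sub>R x)" for x y
  have [measurable]: "case_prod f2 \<in> borel_measurable (borel \<Otimes>\<^sub>M borel)"
    unfolding f2_def by measurable
  have "(\<integral>\<^sup>+x. \<integral>\<^sup>+y. f (cos t *\<^sub>R x + sin t *\<^sub>R y) (cos t *\<^sub>R y - sin t *\<^sub>R x) \<partial>lborel \<partial>lborel)
      = (\<integral>\<^sup>+x. \<integral>\<^sup>+y. f2 (x + a *\<^sub>R y) y \<partial>lborel \<partial>lborel)"
    unfolding f2_def f1_def x y ..
  also have "\<dots> = (\<integral>\<^sup>+x. \<integral>\<^sup>+y. f2 x y \<partial>lborel \<partial>lborel)"
    by (rule nn_integral_lborel_shear_fst) measurable
  also have "\<dots> = (\<integral>\<^sup>+x. \<integral>\<^sup>+y. f1 x y \<partial>lborel \<partial>lborel)"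
    unfolding f2_def by (rule nn_integral_lborel_shear_snd) measurable
  also have "\<dots> = (\<integral>\<^sup>+x. \<integral>\<^sup>+y. f x y \<partial>lborel \<partial>lborel)"
    unfolding f1_def by (rule nn_integral_lborel_shear_fst) measurable
  finally show ?thesis .
qed

text \<open>A rotation preserves \<open>|x|^2 + |y|^2\<close>, and the product density depends on
  nothing else; invariance of Lebesgue measure therefore transfers to the Gaussian.\<close>

lemma gauss_dens_rotate:
  "gauss_dens (cos t *\<^sub>R x + sin t *\<^sub>R y) * gauss_dens (cos t *\<^sub>R y - sin t *\<^sub>R x) = gauss_dens x * gauss_dens y"
proof -
  have "(norm (c *\<^sub>R x + s *\<^sub>R y))\<^sup>2 + (norm (c *\<^sub>R y - s *\<^sub>R x))\<^sup>2
      = (c\<^sup>2 + s\<^sup>2) * ((norm x)\<^sup>2 + (norm y)\<^sup>2)" for c s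
    unfolding power2_norm_eq_inner
    by (simp add: inner_commute algebra_simps power2_eq_square[of c] power2_eq_square[of s])
  from this[of "cos t" "sin t"]
  have "(norm (cos t *\<^sub>R x + sin t *\<^sub>R y))\<^sup>2 + (norm (cos t *\<^sub>R y - sin t *\<^sub>R x))\<^sup>2
      = (norm x)\<^sup>2 + (norm y)\<^sup>2"
    by simp
  then have *: "exp (- (norm (cos t *\<^sub>R x + sin t *\<^sub>R y))\<^sup>2 / 2) * exp (- (norm (cos t *\<^sub>R y - sin t *\<^sub>R x))\<^sup>2 / 2)
      = exp (- (norm x)\<^sup>2 / 2) * exp (- (norm y)\<^sup>2 / 2)"
    by (simp add: exp_add[symmetric] field_simps)
  show ?thesis
    unfolding gauss_dens_def using * by (simp add: mult.assoc mult.left_commute)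
qed

lemma nn_integral_gauss_gauss:
  fixes f :: "real ^ 'n \<Rightarrow> real ^ 'n \<Rightarrow> ennreal"
  assumes [measurable]: "case_prod f \<in> borel_measurable (borel \<Otimes>\<^sub>M borel)"
  shows "(\<integral>\<^sup>+x. \<integral>\<^sup>+y. f x y \<partial>gauss \<partial>gauss) =
    (\<integral>\<^sup>+x. \<integral>\<^sup>+y. ennreal (gauss_dens x * gauss_dens y) * f x y \<partial>lborel \<partial>lborel)"
proof -
  have "(\<integral>\<^sup>+x. \<integral>\<^sup>+y. f x y \<partial>gauss \<partial>gauss) =
      (\<integral>\<^sup>+x. ennreal (gauss_dens x) * (\<integral>\<^sup>+y. ennreal (gauss_dens y) * f x y \<partial>lborel) \<partial>lborel)"
    by (simp add: nn_integral_gauss)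
  also have "\<dots> = (\<integral>\<^sup>+x. \<integral>\<^sup>+y. ennreal (gauss_dens x) * (ennreal (gauss_dens y) * f x y) \<partial>lborel \<partial>lborel)"
    by (intro nn_integral_cong nn_integral_cmult[symmetric]) measurable
  finally show ?thesis
    by (simp add: ennreal_mult' mult.assoc)
qed

lemma nn_integral_gauss_rotate:
  fixes f :: "real ^ 'n \<Rightarrow> real ^ 'n \<Rightarrow> ennreal"
  assumes [measurable]: "case_prod f \<in> borel_measurable (borel \<Otimes>\<^sub>M borel)"
    and t: "cos (t / 2) \<noteq> 0"
  shows "(\<integral>\<^sup>+x. \<integral>\<^sup>+y. f (cos t *\<^sub>R x + sin t *\<^sub>R y) (cos t *\<^sub>R y - sin t *\<^sub>R x) \<partial>gauss \<partial>gauss)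
    = (\<integral>\<^sup>+x. \<integral>\<^sup>+y. f x y \<partial>gauss \<partial>gauss)"
proof -
  define h where "h x y = ennreal (gauss_dens x * gauss_dens y) * f x y" for x y
  have [measurable]: "case_prod h \<in> borel_measurable (borel \<Otimes>\<^sub>M borel)"
    unfolding h_def by measurable
  have "(\<integral>\<^sup>+x. \<integral>\<^sup>+y. f (cos t *\<^sub>R x + sin t *\<^sub>R y) (cos t *\<^sub>R y - sin t *\<^sub>R x) \<partial>gauss \<partial>gauss)
      = (\<integral>\<^sup>+x. \<integral>\<^sup>+y. h (cos t *\<^sub>R x + sin t *\<^sub>R y) (cos t *\<^sub>R y - sin t *\<^sub>R x) \<partial>lborel \<partial>lborel)"
    by (subst nn_integral_gauss_gauss) (simp_all add: h_def gauss_dens_rotate)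
  also have "\<dots> = (\<integral>\<^sup>+x. \<integral>\<^sup>+y. h x y \<partial>lborel \<partial>lborel)"
    by (rule nn_integral_lborel_rotate[OF _ t]) measurable
  also have "\<dots> = (\<integral>\<^sup>+x. \<integral>\<^sup>+y. f x y \<partial>gauss \<partial>gauss)"
    by (subst nn_integral_gauss_gauss) (simp_all add: h_def[abs_def])
  finally show ?thesis .
qed

lemma measurable_rot [measurable]: "rot \<in> gauss \<Otimes>\<^sub>M noise \<rightarrow>\<^sub>M gauss \<Otimes>\<^sub>M noise"
  unfolding rot_def by measurable

lemma nn_integral_gauss_noise:
  fixes f :: "(real ^ 'n) \<times> (real \<times> (real ^ 'n)) \<Rightarrow> ennreal"
  assumes [measurable]: "f \<in> borel_measurable (gauss \<Otimes>\<^sub>M noise)"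
  shows "(\<integral>\<^sup>+p. f p \<partial>(gauss \<Otimes>\<^sub>M noise)) = (\<integral>\<^sup>+t. \<integral>\<^sup>+x. \<integral>\<^sup>+y. f (x, t, y) \<partial>gauss \<partial>gauss \<partial>angle)"
proof -
  have "(\<integral>\<^sup>+p. f p \<partial>(gauss \<Otimes>\<^sub>M noise)) = (\<integral>\<^sup>+x. \<integral>\<^sup>+q. f (x, q) \<partial>noise \<partial>gauss)"
    by (rule sigma_finite_measure.nn_integral_fst[OF sigma_finite_measure_noise, symmetric]) simp
  also have "\<dots> = (\<integral>\<^sup>+x. \<integral>\<^sup>+t. \<integral>\<^sup>+y. f (x, t, y) \<partial>gauss \<partial>angle \<partial>gauss)"
    by (intro nn_integral_cong gauss.nn_integral_fst[symmetric]) measurable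
  also have "\<dots> = (\<integral>\<^sup>+t. \<integral>\<^sup>+x. \<integral>\<^sup>+y. f (x, t, y) \<partial>gauss \<partial>gauss \<partial>angle)"
    by (rule gauss_angle.Fubini'[symmetric]) measurable
  finally show ?thesis .
qed

text \<open>With the angle as outermost variable, Tonelli reduces the claim to a fixed rotation.
  Almost every angle lies strictly between 0 and \<open>pi / 2\<close>, where
  \<open>cos (t / 2)\<close> is nonzero as the shears require.\<close>

lemma distr_rot: "distr (gauss \<Otimes>\<^sub>M noise) (gauss \<Otimes>\<^sub>M noise) rot = (gauss \<Otimes>\<^sub>M noise)"
proof (rule measure_eqI)
  fix A :: "((real ^ 'n) \<times> (real \<times> (real ^ 'n))) set"
  assume "A \<in> sets (distr (gauss \<Otimes>\<^sub>M noise) (gauss \<Otimes>\<^sub>M noise) rot)"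
  then have [measurable]: "A \<in> sets (gauss \<Otimes>\<^sub>M noise)" unfolding sets_distr .
  have half: "cos (t / 2) \<noteq> 0" if "0 < t \<and> t < pi / 2" for t :: real
    using cos_gt_zero[of "t / 2"] that by force
  have "emeasure (distr (gauss \<Otimes>\<^sub>M noise) (gauss \<Otimes>\<^sub>M noise) rot) A
      = (\<integral>\<^sup>+p. indicator A (rot p) \<partial>(gauss \<Otimes>\<^sub>M noise))"
    by (subst nn_integral_indicator[symmetric], simp only: sets_distr, measurable) (subst nn_integral_distr; measurable)
  also have "\<dots> = (\<integral>\<^sup>+t. \<integral>\<^sup>+x. \<integral>\<^sup>+y. indicator A (rot (x, t, y)) \<partial>gauss \<partial>gauss \<partial>angle)"
    by (rule nn_integral_gauss_noise) measurable
  also have "\<dots> = (\<integral>\<^sup>+t. \<integral>\<^sup>+x. \<integral>\<^sup>+y. indicator A (x, t, y) \<partial>gauss \<partial>gauss \<partial>angle)"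
  proof (rule nn_integral_cong_AE, use AE_angle in eventually_elim)
    case (elim t)
    show ?case
      unfolding rot_def prod.case
      by (rule nn_integral_gauss_rotate[OF _ half[OF elim], of "\<lambda>x y. indicator A (x, t, y)"]) measurable
  qed
  also have "\<dots> = emeasure (gauss \<Otimes>\<^sub>M noise) A"
    by (subst nn_integral_gauss_noise[symmetric]; measurable) (subst nn_integral_indicator; measurable)
  finally show "emeasure (distr (gauss \<Otimes>\<^sub>M noise) (gauss \<Otimes>\<^sub>M noise) rot) A = emeasure (gauss \<Otimes>\<^sub>M noise) A" .
qed simp

lemma integrable_rot_iff:
  fixes f :: "_ \<Rightarrow> 'b :: {banach, second_countable_topology}"
  assumes "f \<in> borel_measurable (gauss \<Otimes>\<^sub>M noise)"
  shows "integrable (gauss \<Otimes>\<^sub>M noise) (\<lambda>p. f (rot p)) \<longleftrightarrow> integrable (gauss \<Otimes>\<^sub>M noise) f"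
  using integrable_distr_eq[OF measurable_rot assms] by (simp add: distr_rot)

lemma integral_rot:
  fixes f :: "_ \<Rightarrow> 'b :: {banach, second_countable_topology}"
  assumes "f \<in> borel_measurable (gauss \<Otimes>\<^sub>M noise)"
  shows "(\<integral>p. f (rot p) \<partial>(gauss \<Otimes>\<^sub>M noise)) = (\<integral>p. f p \<partial>(gauss \<Otimes>\<^sub>M noise))"
  using integral_distr[OF measurable_rot assms] by (simp add: distr_rot)

section \<open>The resolvent and its weak equation\<close>

lemma AE_noise: "AE q in noise. 0 < fst q \<and> fst q < pi / 2"
proof (rule angle_gauss.AE_pair_measure)
  show "{q \<in> space noise. 0 < fst q \<and> fst q < pi / 2} \<in> sets noise" by measurable
  show "AE t in angle. AE y in gauss. 0 < fst (t, y) \<and> fst (t, y) < pi / 2"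
    using AE_angle by eventually_elim simp
qed

definition mix :: "real ^ 'n \<Rightarrow> real \<times> (real ^ 'n) \<Rightarrow> real ^ 'n" where
  "mix x q = cos (fst q) *\<^sub>R x + sin (fst q) *\<^sub>R snd q"

text \<open>The weight may be vector-valued, so that the resolvent and its gradient are two
  instances and share one \<open>L\<^sup>2\<close> bound.\<close>

definition avg :: "(real \<times> (real ^ 'n) \<Rightarrow> 'b :: euclidean_space) \<Rightarrow> (real ^ 'n \<Rightarrow> real) \<Rightarrow> real ^ 'n \<Rightarrow> 'b" where
  "avg W g x = (\<integral>q. g (mix x q) *\<^sub>R W q \<partial>noise)"

lemma measurable_mix [measurable]:
  assumes f: "f \<in> M \<rightarrow>\<^sub>M gauss" and h: "h \<in> M \<rightarrow>\<^sub>M noise"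
  shows "(\<lambda>p. mix (f p) (h p)) \<in> M \<rightarrow>\<^sub>M gauss"
proof -
  define a b where "a p = fst (h p)" and "b p = snd (h p)" for p
  have [measurable]: "a \<in> borel_measurable M" "b \<in> borel_measurable M"
    using measurable_compose[OF h measurable_fst] measurable_compose[OF h measurable_snd]
    unfolding a_def[abs_def] b_def[abs_def]
    by (simp_all only: measurable_cong_sets[OF refl sets_angle] measurable_cong_sets[OF refl sets_gauss])
  have [measurable]: "f \<in> borel_measurable M"
    using f by (simp only: measurable_cong_sets[OF refl sets_gauss])
  have "(\<lambda>p. cos (a p) *\<^sub>R f p + sin (a p) *\<^sub>R b p) \<in> borel_measurable M"
    by measurable
  then show ?thesis
    by (simp add: mix_def a_def b_def)
qed

lemma emeasure_gauss_UNIV [simp]: "emeasure gauss UNIV = 1"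
  using gauss.emeasure_space_1 by simp

lemma measure_noise: "measure (noise :: (real \<times> (real ^ 'n)) measure) UNIV = pi / 2"
proof -
  have "emeasure (noise :: (real \<times> (real ^ 'n)) measure) (UNIV \<times> UNIV) = ennreal (pi / 2)"
    by (subst gauss.emeasure_pair_measure_Times)
      (simp_all add: emeasure_angle)
  then show ?thesis
    by (simp add: measure_def)
qed

lemma mix_eq_fst_rot: "mix (fst p) (snd p) = fst (rot p)"
  by (simp add: mix_def rot_def case_prod_beta)

lemma integrable_gauss_noise_fst:
  fixes f :: "real ^ 'n \<Rightarrow> real"
  assumes f: "integrable gauss f"
  shows "integrable (gauss \<Otimes>\<^sub>M noise) (\<lambda>p. f (fst p))"
    and "(\<integral>p. f (fst p) \<partial>(gauss \<Otimes>\<^sub>M noise)) = (pi / 2) * (\<integral>x. f x \<partial>gauss)"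
proof -
  have [measurable]: "f \<in> borel_measurable gauss" using f by auto
  show *: "integrable (gauss \<Otimes>\<^sub>M noise) (\<lambda>p. f (fst p))"
    by (rule gauss_noise.Fubini_integrable) (use f in auto)
  show "(\<integral>p. f (fst p) \<partial>(gauss \<Otimes>\<^sub>M noise)) = (pi / 2) * (\<integral>x. f x \<partial>gauss)"
    by (subst gauss_noise.integral_fst'[OF *, symmetric]) (simp add: space_pair_measure measure_noise)
qed

text \<open>By rotation invariance the mixed point has the same distribution as the first
  coordinate; the factor \<open>pi / 2\<close> is the total mass of the noise.\<close>

lemma square_integrable_mix:
  fixes g :: "real ^ 'n \<Rightarrow> real"
  assumes g: "square_integrable gauss g"
  shows "square_integrable (gauss \<Otimes>\<^sub>M noise) (\<lambda>p. g (mix (fst p) (snd p)))"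
    and "(\<integral>p. (g (mix (fst p) (snd p)))\<^sup>2 \<partial>(gauss \<Otimes>\<^sub>M noise)) = (pi / 2) * (\<integral>x. (g x)\<^sup>2 \<partial>gauss)"
proof -
  note [measurable] = square_integrable_measurable[OF g]
  note i = integrable_gauss_noise_fst[OF square_integrable_real_power2[OF g]]
  have "integrable (gauss \<Otimes>\<^sub>M noise) (\<lambda>p. (g (mix (fst p) (snd p)))\<^sup>2)"
    unfolding mix_eq_fst_rot using i(1)
    by (subst integrable_rot_iff[of "\<lambda>p. (g (fst p))\<^sup>2"]) auto
  then show "square_integrable (gauss \<Otimes>\<^sub>M noise) (\<lambda>p. g (mix (fst p) (snd p)))"
    unfolding square_integrable_def by simp
  show "(\<integral>p. (g (mix (fst p) (snd p)))\<^sup>2 \<partial>(gauss \<Otimes>\<^sub>M noise)) = (pi / 2) * (\<integral>x. (g x)\<^sup>2 \<partial>gauss)"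
    unfolding mix_eq_fst_rot using i(2)
    by (subst integral_rot[of "\<lambda>p. (g (fst p))\<^sup>2"]) auto
qed

text \<open>Fubini leaves an exceptional null set of \<open>x\<close>. It is harmless under
  integrals over \<open>x\<close>; for convex \<open>g\<close>, integrability is extended to every
  \<open>x\<close> later.\<close>

lemma AE_square_integrable_mix:
  fixes g :: "real ^ 'n \<Rightarrow> real"
  assumes g: "square_integrable gauss g"
  shows "AE x in gauss. square_integrable noise (\<lambda>q. g (mix x q))"
proof -
  note [measurable] = square_integrable_measurable[OF g]
  have "AE x in gauss. integrable noise (\<lambda>q. (g (mix x q))\<^sup>2)"
    using gauss_noise.AE_integrable_fst'[OF square_integrable_real_power2[OF square_integrable_mix(1)[OF g]]]
    by simp
  then show ?thesis
    unfolding square_integrable_def by eventually_elim auto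
qed

lemma square_integrable_integrable:
  assumes "finite_measure M" "square_integrable M f"
  shows "integrable M f"
proof -
  interpret finite_measure M by fact
  have "integrable M (\<lambda>x. norm (f x) * 1)"
    by (rule square_integrable_mult) (use assms(2) in \<open>auto simp: square_integrable_def\<close>)
  then show ?thesis
    using assms(2) by (simp add: integrable_norm_iff square_integrable_def)
qed

lemma norm_integral_scaleR_power2_le:
  fixes f :: "'a \<Rightarrow> real" and W :: "'a \<Rightarrow> 'b :: euclidean_space"
  assumes f: "square_integrable M f" and W: "square_integrable M W"
  shows "(norm (\<integral>x. f x *\<^sub>R W x \<partial>M))\<^sup>2 \<le> (\<integral>x. (f x)\<^sup>2 \<partial>M) * (\<integral>x. (norm (W x))\<^sup>2 \<partial>M)"
proof -
  have f': "square_integrable M (\<lambda>x. \<bar>f x\<bar>)" and W': "square_integrable M (\<lambda>x. norm (W x))"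
    using f W by (auto simp: square_integrable_def)
  have "norm (\<integral>x. f x *\<^sub>R W x \<partial>M) \<le> (\<integral>x. norm (f x *\<^sub>R W x) \<partial>M)"
    by (rule integral_norm_bound)
  then have "(norm (\<integral>x. f x *\<^sub>R W x \<partial>M))\<^sup>2 \<le> (\<integral>x. \<bar>f x\<bar> \<bullet> norm (W x) \<partial>M)\<^sup>2"
    by (intro power_mono) auto
  also have "\<dots> \<le> (\<integral>x. (f x)\<^sup>2 \<partial>M) * (\<integral>x. (norm (W x))\<^sup>2 \<partial>M)"
    using Cauchy_Schwarz_integral[OF f' W'] by simp
  finally show ?thesis .
qed

lemma integrable_scaleR_square_integrable:
  fixes f :: "'a \<Rightarrow> real" and W :: "'a \<Rightarrow> 'b :: euclidean_space"
  assumes f: "square_integrable M f" and W: "square_integrable M W"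
  shows "integrable M (\<lambda>x. f x *\<^sub>R W x)"
proof -
  note [measurable] = f[THEN square_integrable_measurable] W[THEN square_integrable_measurable]
  have "square_integrable M (\<lambda>x. \<bar>f x\<bar>)" "square_integrable M (\<lambda>x. norm (W x))"
    using f W by (auto simp: square_integrable_def)
  then have "integrable M (\<lambda>x. \<bar>f x\<bar> * norm (W x))"
    by (rule square_integrable_mult)
  then show ?thesis
    by (rule Bochner_Integration.integrable_bound) auto
qed

lemma measurable_avg [measurable]:
  fixes W :: "real \<times> (real ^ 'n) \<Rightarrow> 'b :: euclidean_space"
  assumes [measurable]: "W \<in> borel_measurable noise" "g \<in> borel_measurable gauss"
  shows "avg W g \<in> borel_measurable gauss"
  unfolding avg_def[abs_def]
  by (rule sigma_finite_measure.borel_measurable_lebesgue_integral[OF sigma_finite_measure_noise]) measurable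

text \<open>Cauchy-Schwarz in the noise at fixed \<open>x\<close>, then rotation invariance after
  integrating in \<open>x\<close>. The bound makes averaging a continuous operator on
  \<open>L\<^sup>2\<close>, as the density argument requires.\<close>

lemma square_integrable_avg:
  fixes W :: "real \<times> (real ^ 'n) \<Rightarrow> 'b :: euclidean_space"
  assumes W: "square_integrable noise W" and g: "square_integrable gauss g"
  shows "square_integrable gauss (avg W g)"
    and "(\<integral>x. (norm (avg W g x))\<^sup>2 \<partial>gauss) \<le>
      (\<integral>q. (norm (W q))\<^sup>2 \<partial>noise) * (pi / 2) * (\<integral>x. (g x)\<^sup>2 \<partial>gauss)"
proof -
  note [measurable] = W[THEN square_integrable_measurable] g[THEN square_integrable_measurable]
  define K where "K = (\<integral>q. (norm (W q))\<^sup>2 \<partial>noise)"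
  have "0 \<le> K" by (simp add: K_def)
  define J where "J x = (\<integral>q. (g (mix x q))\<^sup>2 \<partial>noise)" for x
  have i: "integrable (gauss \<Otimes>\<^sub>M noise) (\<lambda>p. (g (mix (fst p) (snd p)))\<^sup>2)"
    by (intro square_integrable_real_power2 square_integrable_mix g)
  have J: "integrable gauss J" "(\<integral>x. J x \<partial>gauss) = (pi / 2) * (\<integral>x. (g x)\<^sup>2 \<partial>gauss)"
    using gauss_noise.integrable_fst'[OF i] gauss_noise.integral_fst'[OF i] square_integrable_mix(2)[OF g]
    by (simp_all add: J_def[abs_def])
  have le: "AE x in gauss. (norm (avg W g x))\<^sup>2 \<le> K * J x"
    using AE_square_integrable_mix[OF g]
  proof eventually_elim
    case (elim x)
    from norm_integral_scaleR_power2_le[OF this W] show ?case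
      by (simp add: avg_def K_def J_def mult.commute)
  qed
  have int: "integrable gauss (\<lambda>x. (norm (avg W g x))\<^sup>2)"
    by (rule Bochner_Integration.integrable_bound[where f = "\<lambda>x. K * J x"])
      (use le J in \<open>auto elim!: eventually_mono\<close>)
  then show "square_integrable gauss (avg W g)"
    unfolding square_integrable_def by simp
  have "(\<integral>x. (norm (avg W g x))\<^sup>2 \<partial>gauss) \<le> (\<integral>x. K * J x \<partial>gauss)"
    using int le J by (intro integral_mono_AE) auto
  then show "(\<integral>x. (norm (avg W g x))\<^sup>2 \<partial>gauss) \<le>
      (\<integral>q. (norm (W q))\<^sup>2 \<partial>noise) * (pi / 2) * (\<integral>x. (g x)\<^sup>2 \<partial>gauss)"
    using J by (simp add: K_def)
qed

lemma avg_diff: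
  assumes W: "square_integrable noise W" and f: "square_integrable gauss f" and g: "square_integrable gauss g"
  shows "AE x in gauss. avg W (\<lambda>x. f x - g x) x = avg W f x - avg W g x"
  using AE_square_integrable_mix[OF f] AE_square_integrable_mix[OF g]
proof eventually_elim
  case (elim x)
  then show ?case
    by (simp add: avg_def scaleR_diff_left integrable_scaleR_square_integrable W)
qed

text \<open>In \<open>res_grad g\<close> the derivative of the resolvent \<open>res g\<close> has been moved from \<open>g\<close> onto the
  Gaussian, so it makes sense for every square integrable \<open>g\<close>.\<close>
definition res :: "(real ^ 'n \<Rightarrow> real) \<Rightarrow> real ^ 'n \<Rightarrow> real" where
  "res g = avg (\<lambda>q. sin (fst q)) g"

definition res_grad :: "(real ^ 'n \<Rightarrow> real) \<Rightarrow> real ^ 'n \<Rightarrow> real ^ 'n" where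
  "res_grad g = avg (\<lambda>q. cos (fst q) *\<^sub>R snd q) g"

lemma square_integrable_noise_bounded:
  fixes W :: "real \<times> (real ^ 'n) \<Rightarrow> 'b :: euclidean_space"
  assumes "W \<in> borel_measurable noise" "\<And>q. norm (W q) \<le> B"
  shows "square_integrable noise W"
  unfolding square_integrable_def
proof
  show "integrable noise (\<lambda>q. (norm (W q))\<^sup>2)"
    by (rule noise.integrable_const_bound[where B = "B\<^sup>2"])
      (use assms in \<open>auto intro!: power_mono\<close>)
qed fact

lemma square_integrable_gauss_bounded:
  fixes f :: "real ^ 'n \<Rightarrow> 'b :: euclidean_space"
  assumes "f \<in> borel_measurable borel" "\<And>x. norm (f x) \<le> B"
  shows "square_integrable gauss f"
  unfolding square_integrable_def
proof
  show "integrable gauss (\<lambda>x. (norm (f x))\<^sup>2)"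
    by (rule gauss.integrable_const_bound[where B = "B\<^sup>2"])
      (use assms in \<open>auto intro!: AE_I2 power_mono\<close>)
qed (use assms in auto)

lemma square_integrable_noise_snd: "square_integrable noise (\<lambda>q. snd q)"
  unfolding square_integrable_def
proof
  show "integrable noise (\<lambda>q. (norm (snd q))\<^sup>2)"
    by (rule angle_gauss.Fubini_integrable) (use integrable_gauss_norm_power2 in auto)
qed measurable

lemma square_integrable_res_weight: "square_integrable noise (\<lambda>q. sin (fst q))"
  by (rule square_integrable_noise_bounded[where B = 1]) auto

lemma square_integrable_res_grad_weight: "square_integrable noise (\<lambda>q. cos (fst q) *\<^sub>R snd q)"
  by (rule square_integrable_bound[OF square_integrable_noise_snd])
    (auto simp: mult_left_le_one_le)

lemmas square_integrable_res = square_integrable_avg(1)[OF square_integrable_res_weight, folded res_def]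
lemmas square_integrable_res_grad = square_integrable_avg(1)[OF square_integrable_res_grad_weight, folded res_grad_def]

section \<open>Weak equation for bounded test functions with bounded continuous gradient\<close>

lemma integral_angle:
  fixes f :: "real \<Rightarrow> real"
  assumes "f \<in> borel_measurable borel"
  shows "(\<integral>t. f t \<partial>angle) = (\<integral>t. indicator {0..pi/2} t *\<^sub>R f t \<partial>lborel)"
proof -
  have angle_density: "angle = density lborel (\<lambda>t. ennreal (indicator {0..pi/2} t))"
    by (simp add: angle_def ennreal_indicator)
  then show ?thesis
    by (simp only: angle_density) (subst integral_density; use assms in simp)
qed

text \<open>The integrand is the derivative of
  \<open>- cos t * \<phi> (cos t *\<^sub>R x - sin t *\<^sub>R y)\<close>, which vanishes at
  \<open>pi / 2\<close> and equals \<open>- \<phi> x\<close> at 0. Thus \<open>y\<close> drops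
  out.\<close>

lemma integral_angle_total_derivative:
  fixes \<phi> :: "real ^ 'n \<Rightarrow> real"
  assumes der: "\<And>x. (\<phi> has_derivative (\<lambda>h. D x \<bullet> h)) (at x)" and D: "continuous_on UNIV D"
  shows "(\<integral>t. cos t * ((sin t *\<^sub>R x + cos t *\<^sub>R y) \<bullet> D (cos t *\<^sub>R x - sin t *\<^sub>R y)) +
      sin t * \<phi> (cos t *\<^sub>R x - sin t *\<^sub>R y) \<partial>angle) = \<phi> x"
proof -
  define F where "F t = - cos t * \<phi> (cos t *\<^sub>R x - sin t *\<^sub>R y)" for t
  define f where "f t = cos t * ((sin t *\<^sub>R x + cos t *\<^sub>R y) \<bullet> D (cos t *\<^sub>R x - sin t *\<^sub>R y)) +
      sin t * \<phi> (cos t *\<^sub>R x - sin t *\<^sub>R y)" for t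
  have \<phi>: "continuous_on UNIV \<phi>"
    using der by (intro continuous_at_imp_continuous_on) (blast intro: has_derivative_continuous)
  have f: "continuous_on S f" for S
    unfolding f_def
    by (intro continuous_intros continuous_on_compose2[OF D] continuous_on_compose2[OF \<phi>]) auto
  have F: "(F has_vector_derivative f t) (at t within {0..pi/2})" for t
  proof -
    have 1: "((\<lambda>t. cos t *\<^sub>R x - sin t *\<^sub>R y) has_derivative (\<lambda>h. h *\<^sub>R (- sin t *\<^sub>R x - cos t *\<^sub>R y))) (at t)"
      by (auto intro!: derivative_eq_intros simp: algebra_simps)
    have 2: "((\<lambda>t. \<phi> (cos t *\<^sub>R x - sin t *\<^sub>R y)) has_derivative
        (\<lambda>h. D (cos t *\<^sub>R x - sin t *\<^sub>R y) \<bullet> (h *\<^sub>R (- sin t *\<^sub>R x - cos t *\<^sub>R y)))) (at t)"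
      by (rule has_derivative_compose[OF 1 der])
    have "(F has_derivative (\<lambda>h. h *\<^sub>R f t)) (at t)"
      unfolding F_def f_def
      by (rule derivative_eq_intros 2 refl)+
        (auto simp: fun_eq_iff algebra_simps inner_commute)
    then show ?thesis
      unfolding has_vector_derivative_def by (rule has_derivative_at_withinI)
  qed
  have "(\<integral>t. f t \<partial>angle) = (\<integral>t. indicator {0..pi/2} t *\<^sub>R f t \<partial>lborel)"
    by (intro integral_angle borel_measurable_continuous_onI f)
  also have "\<dots> = F (pi / 2) - F 0"
    by (rule integral_FTC_Icc[OF _ F f]) simp
  finally show ?thesis
    by (simp add: f_def F_def)
qed

text \<open>After rotating \<open>(x, y)\<close> by \<open>t\<close> the integrand of the left-hand side becomes \<open>g x\<close> times a
  total derivative in \<open>t\<close>, so no integration by parts is needed.\<close>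
lemma res_weak_equation:
  fixes g :: "real ^ 'n \<Rightarrow> real" and \<phi> :: "real ^ 'n \<Rightarrow> real"
  assumes g: "square_integrable gauss g"
    and der: "\<And>x. (\<phi> has_derivative (\<lambda>h. D x \<bullet> h)) (at x)" and D: "continuous_on UNIV D"
    and B: "\<And>x. \<bar>\<phi> x\<bar> \<le> B" "\<And>x. norm (D x) \<le> C"
  shows "(\<integral>x. res_grad g x \<bullet> D x \<partial>gauss) + (\<integral>x. res g x * \<phi> x \<partial>gauss) = (\<integral>x. g x * \<phi> x \<partial>gauss)"
proof -
  note [measurable] = square_integrable_measurable[OF g]
  have "continuous_on UNIV \<phi>"
    using der by (intro continuous_at_imp_continuous_on) (blast intro: has_derivative_continuous)
  then have [measurable]: "\<phi> \<in> borel_measurable borel" by (rule borel_measurable_continuous_onI)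
  have [measurable]: "D \<in> borel_measurable borel" by (rule borel_measurable_continuous_onI) fact
  have "0 \<le> B" "0 \<le> C" using B(1)[of 0] B(2)[of 0] norm_ge_zero[of "D 0"] abs_ge_zero[of "\<phi> 0"] by linarith+
  \<comment> \<open>\<open>g (mix x q) * w (x, q)\<close> is the integrand that appears when
    \<open>res\<close> and \<open>res_grad\<close> are written out as averages.\<close>
  define w where "w p = cos (fst (snd p)) * (snd (snd p) \<bullet> D (fst p)) + sin (fst (snd p)) * \<phi> (fst p)"
    for p :: "(real ^ 'n) \<times> (real \<times> (real ^ 'n))"
  have [measurable]: "w \<in> borel_measurable (gauss \<Otimes>\<^sub>M noise)" unfolding w_def by measurable
  \<comment> \<open>The same integrand after the inverse rotation: \<open>g\<close> is evaluated at
    \<open>x\<close> itself, and all dependence on the angle sits in the factor built from the test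
    function.\<close>
  define k where "k = (\<lambda>(x, t, y). g x * (cos t * ((sin t *\<^sub>R x + cos t *\<^sub>R y) \<bullet> D (cos t *\<^sub>R x - sin t *\<^sub>R y)) +
      sin t * \<phi> (cos t *\<^sub>R x - sin t *\<^sub>R y)))"
  have [measurable]: "k \<in> borel_measurable (gauss \<Otimes>\<^sub>M noise)" unfolding k_def by measurable
  \<comment> \<open>The factor \<open>y\<close> is unbounded, so the bounds \<open>B\<close> and
    \<open>C\<close> are combined with the Gaussian second moment.\<close>
  have w: "square_integrable (gauss \<Otimes>\<^sub>M noise) w"
  proof (rule square_integrable_bound)
    have 1: "integrable (gauss \<Otimes>\<^sub>M noise) (\<lambda>p. (norm (snd (snd p)))\<^sup>2)"
      by (rule gauss_noise.Fubini_integrable)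
        (use square_integrable_norm_power2[OF square_integrable_noise_snd] in auto)
    have "square_integrable (gauss \<Otimes>\<^sub>M noise) (\<lambda>p. norm (snd (snd p)))"
      unfolding square_integrable_def using 1 by simp
    moreover have "square_integrable (gauss \<Otimes>\<^sub>M noise) (\<lambda>p. B)"
      unfolding square_integrable_def by simp
    ultimately show "square_integrable (gauss \<Otimes>\<^sub>M noise) (\<lambda>p. C * norm (snd (snd p)) + B)"
      by (intro square_integrable_add square_integrable_cmult)
    show "AE p in gauss \<Otimes>\<^sub>M noise. norm (w p) \<le> norm (C * norm (snd (snd p)) + B)"
    proof (rule AE_I2)
      fix p :: "(real ^ 'n) \<times> (real \<times> (real ^ 'n))"
      have "\<bar>cos (fst (snd p)) * (snd (snd p) \<bullet> D (fst p))\<bar> \<le> 1 * (C * norm (snd (snd p)))"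
        unfolding abs_mult
        using Cauchy_Schwarz_ineq2[of "snd (snd p)" "D (fst p)"] mult_left_mono[OF B(2)[of "fst p"] norm_ge_zero[of "snd (snd p)"]]
        by (intro mult_mono) (auto simp: mult.commute)
      moreover have "\<bar>sin (fst (snd p)) * \<phi> (fst p)\<bar> \<le> 1 * B"
        unfolding abs_mult using B(1)[of "fst p"] by (intro mult_mono) auto
      ultimately show "norm (w p) \<le> norm (C * norm (snd (snd p)) + B)"
        unfolding w_def by simp
    qed
  qed measurable
  have K: "g (mix (fst p) (snd p)) * w p = k (rot p)" for p
  proof -
    obtain x t y where p: "p = (x, t, y)" by (cases p)
    have r: "(cos t)\<^sup>2 *\<^sub>R z + (sin t)\<^sup>2 *\<^sub>R z = z" for z :: "real ^ 'n"
      by (simp add: scaleR_add_left[symmetric])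
    have a: "cos t *\<^sub>R (cos t *\<^sub>R x + sin t *\<^sub>R y) - sin t *\<^sub>R (cos t *\<^sub>R y - sin t *\<^sub>R x) = x"
      using r[of x] by (simp add: algebra_simps power2_eq_square)
    have b: "sin t *\<^sub>R (cos t *\<^sub>R x + sin t *\<^sub>R y) + cos t *\<^sub>R (cos t *\<^sub>R y - sin t *\<^sub>R x) = y"
      using r[of y] by (simp add: algebra_simps power2_eq_square)
    show ?thesis
      by (simp add: p w_def k_def rot_def mix_def a b)
  qed
  have Kint: "integrable (gauss \<Otimes>\<^sub>M noise) (\<lambda>p. g (mix (fst p) (snd p)) * w p)"
    by (rule square_integrable_mult[OF square_integrable_mix(1)[OF g] w])
  then have kint: "integrable (gauss \<Otimes>\<^sub>M noise) k"
    unfolding K by (subst (asm) integrable_rot_iff) auto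
  have "AE x in gauss. (\<integral>q. k (x, q) \<partial>noise) = g x * \<phi> x"
    using gauss_noise.AE_integrable_fst'[OF kint]
  proof eventually_elim
    case (elim x)
    \<comment> \<open>The angle is integrated first, with \<open>x\<close> and \<open>y\<close>
      fixed, because the total derivative is one in the angle.\<close>
    have "(\<integral>q. k (x, q) \<partial>noise) = (\<integral>y. \<integral>t. k (x, t, y) \<partial>angle \<partial>gauss)"
      using elim by (subst angle_gauss.integral_snd[of "\<lambda>t y. k (x, t, y)"]) (simp_all add: case_prod_beta')
    also have "\<dots> = (\<integral>y. g x * \<phi> x \<partial>(gauss :: (real ^ 'n) measure))"
      unfolding k_def prod.case integral_mult_right_zero
      by (simp add: integral_angle_total_derivative[OF der D])
    also have "\<dots> = g x * \<phi> x"
      by (simp add: gauss.prob_space[simplified])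
    finally show ?case .
  qed
  then have k_eq: "(\<integral>p. k p \<partial>(gauss \<Otimes>\<^sub>M noise)) = (\<integral>x. g x * \<phi> x \<partial>gauss)"
    unfolding gauss_noise.integral_fst'[OF kint, symmetric] by (intro integral_cong_AE) auto
  have \<phi>2: "square_integrable gauss \<phi>" "square_integrable gauss D"
    using B by (auto intro!: square_integrable_gauss_bounded)
  have i: "integrable gauss (\<lambda>x. res_grad g x \<bullet> D x)" "integrable gauss (\<lambda>x. res g x * \<phi> x)"
    by (intro square_integrable_inner square_integrable_mult square_integrable_res_grad square_integrable_res g \<phi>2)+
  have "AE x in gauss. (\<integral>q. g (mix x q) * w (x, q) \<partial>noise) = res_grad g x \<bullet> D x + res g x * \<phi> x"
    using AE_square_integrable_mix[OF g]
  proof eventually_elim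
    case (elim x)
    note j = integrable_scaleR_square_integrable[OF elim square_integrable_res_weight]
      integrable_scaleR_square_integrable[OF elim square_integrable_res_grad_weight]
    have "(\<integral>q. g (mix x q) * w (x, q) \<partial>noise) =
        (\<integral>q. (g (mix x q) *\<^sub>R (cos (fst q) *\<^sub>R snd q)) \<bullet> D x + (g (mix x q) *\<^sub>R sin (fst q)) * \<phi> x \<partial>noise)"
      by (intro Bochner_Integration.integral_cong refl) (simp add: w_def algebra_simps)
    also have "\<dots> = res_grad g x \<bullet> D x + res g x * \<phi> x"
      unfolding res_def res_grad_def avg_def
      by (subst Bochner_Integration.integral_add)
        (rule integrable_inner_left integrable_mult_left j | simp only: integral_inner_left j(2) integral_mult_left_zero)+
    finally show ?case .
  qed
  then have "(\<integral>p. g (mix (fst p) (snd p)) * w p \<partial>(gauss \<Otimes>\<^sub>M noise)) =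
      (\<integral>x. res_grad g x \<bullet> D x + res g x * \<phi> x \<partial>gauss)"
    unfolding gauss_noise.integral_fst'[OF Kint, symmetric] using i by (intro integral_cong_AE) auto
  moreover have "(\<integral>p. g (mix (fst p) (snd p)) * w p \<partial>(gauss \<Otimes>\<^sub>M noise)) = (\<integral>x. g x * \<phi> x \<partial>gauss)"
    unfolding K k_eq[symmetric] by (rule integral_rot) measurable
  ultimately show ?thesis
    using i by simp
qed

section \<open>Smooth functions\<close>

lemma dderiv_append: "dderiv (dderiv f vs) ws = dderiv f (ws @ vs)"
  by (induction ws) auto

lemma smooth_fun_dderiv: "smooth_fun f \<Longrightarrow> smooth_fun (dderiv f vs)"
  by (simp add: smooth_fun_def dderiv_append)

lemma smooth_fun_differentiable: "smooth_fun f \<Longrightarrow> f differentiable (at x)"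
  unfolding smooth_fun_def by (metis dderiv.simps(1))

text \<open>An invariant class replaces formulas for iterated derivatives: for linear combinations,
  averages and bump products, one derivative is again a function of the same kind.\<close>

lemma smooth_fun_coinduct:
  assumes "P f"
    and "\<And>f x. P f \<Longrightarrow> f differentiable (at x)"
    and "\<And>f v. P f \<Longrightarrow> P (\<lambda>x. frechet_derivative f (at x) v)"
  shows "smooth_fun f"
proof -
  have "P (dderiv f vs)" for vs
    by (induction vs) (use assms in auto)
  then show ?thesis
    unfolding smooth_fun_def using assms(2) by blast
qed

lemma inner_grad:
  assumes "f differentiable (at x)"
  shows "grad f x \<bullet> v = frechet_derivative f (at x) v"
proof -
  have lin: "linear (frechet_derivative f (at x))"
    using assms by (rule linear_frechet_derivative)
  have "frechet_derivative f (at x) v = frechet_derivative f (at x) (\<Sum>i\<in>UNIV. (v $ i) *\<^sub>R axis i 1)"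
    by (simp add: basis_expansion scalar_mult_eq_scaleR[symmetric])
  also have "\<dots> = (\<Sum>i\<in>UNIV. (v $ i) * frechet_derivative f (at x) (axis i 1))"
    by (simp add: linear_sum[OF lin] linear_cmul[OF lin])
  finally show ?thesis
    by (simp add: grad_def inner_vec_def mult.commute)
qed

lemma has_derivative_grad:
  assumes "f differentiable (at x)"
  shows "(f has_derivative (\<lambda>v. grad f x \<bullet> v)) (at x)"
  using assms by (simp add: inner_grad frechet_derivative_works)

lemma has_derivative_inner_unique:
  fixes f :: "real ^ 'n \<Rightarrow> real"
  assumes "(f has_derivative (\<lambda>v. a \<bullet> v)) (at x)"
  shows "grad f x = a" "frechet_derivative f (at x) v = a \<bullet> v"
proof -
  have *: "frechet_derivative f (at x) = (\<lambda>v. a \<bullet> v)"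
    using frechet_derivative_at[OF assms] by simp
  then show "frechet_derivative f (at x) v = a \<bullet> v" by simp
  show "grad f x = a"
    by (simp add: grad_def * vec_eq_iff inner_axis)
qed

lemma smooth_fun_continuous: "smooth_fun f \<Longrightarrow> continuous_on S f"
  by (meson continuous_at_imp_continuous_on differentiable_imp_continuous_within smooth_fun_differentiable)

lemma smooth_fun_dderiv1: "smooth_fun f \<Longrightarrow> smooth_fun (\<lambda>x. frechet_derivative f (at x) v)"
  using smooth_fun_dderiv[of f "[v]"] by simp

lemma continuous_on_grad: "smooth_fun f \<Longrightarrow> continuous_on S (grad f)"
  unfolding grad_def[abs_def]
  by (intro continuous_on_vec_lambda smooth_fun_continuous smooth_fun_dderiv1)

lemma smooth_fun_lincomb:
  assumes "smooth_fun f" "smooth_fun g"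
  shows "smooth_fun (\<lambda>x. a * f x + b * g x)"
proof (rule smooth_fun_coinduct[where P = "\<lambda>h. \<exists>f g. smooth_fun f \<and> smooth_fun g \<and> h = (\<lambda>x. a * f x + b * g x)"])
  show "\<exists>f' g'. smooth_fun f' \<and> smooth_fun g' \<and> (\<lambda>x. a * f x + b * g x) = (\<lambda>x. a * f' x + b * g' x)"
    using assms by blast
next
  fix h x assume "\<exists>f g. smooth_fun f \<and> smooth_fun g \<and> h = (\<lambda>x. a * f x + b * g x)"
  then show "h differentiable (at x)"
    by (auto intro!: differentiable_add differentiable_mult intro: smooth_fun_differentiable)
next
  fix h v assume "\<exists>f g. smooth_fun f \<and> smooth_fun g \<and> h = (\<lambda>x. a * f x + b * g x)"
  then obtain f g where *: "smooth_fun f" "smooth_fun g" "h = (\<lambda>x. a * f x + b * g x)"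
    by blast
  have "(h has_derivative (\<lambda>v. (a *\<^sub>R grad f x + b *\<^sub>R grad g x) \<bullet> v)) (at x)" for x
    unfolding *
    by (rule derivative_eq_intros has_derivative_grad[OF smooth_fun_differentiable] * refl)+
      (simp add: inner_add_left)
  from has_derivative_inner_unique(2)[OF this]
  have "(\<lambda>x. frechet_derivative h (at x) v) =
      (\<lambda>x. a * frechet_derivative f (at x) v + b * frechet_derivative g (at x) v)"
    by (simp add: inner_add_left inner_grad smooth_fun_differentiable *)
  then show "\<exists>f g. smooth_fun f \<and> smooth_fun g \<and>
      (\<lambda>x. frechet_derivative h (at x) v) = (\<lambda>x. a * f x + b * g x)"
    using smooth_fun_dderiv1 * by blast
qed

lemma smooth_cpt_smooth_fun: "smooth_cpt f \<Longrightarrow> smooth_fun f"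
  by (simp add: smooth_cpt_def)

lemma smooth_cptI:
  assumes "smooth_fun f" "\<And>x. f x \<noteq> 0 \<Longrightarrow> norm x \<le> R"
  shows "smooth_cpt f"
  unfolding smooth_cpt_def compact_closure bounded_iff using assms by blast

lemma smooth_cptE:
  assumes "smooth_cpt f"
  obtains R where "0 \<le> R" "\<And>x. f x \<noteq> 0 \<Longrightarrow> norm x \<le> R"
proof -
  have "bounded {x. f x \<noteq> 0}"
    using assms by (simp add: smooth_cpt_def compact_closure)
  then obtain R where "\<forall>x\<in>{x. f x \<noteq> 0}. norm x \<le> R" by (auto simp: bounded_iff)
  then show ?thesis
    by (intro that[of "max R 0"]) auto
qed

lemma smooth_cpt_lincomb:
  assumes "smooth_cpt f" "smooth_cpt g"
  shows "smooth_cpt (\<lambda>x. a * f x + b * g x)"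
proof -
  obtain R where R: "\<And>x. f x \<noteq> 0 \<Longrightarrow> norm x \<le> R" using smooth_cptE[OF assms(1)] by blast
  obtain S where S: "\<And>x. g x \<noteq> 0 \<Longrightarrow> norm x \<le> S" using smooth_cptE[OF assms(2)] by blast
  show ?thesis
  proof (rule smooth_cptI)
    show "smooth_fun (\<lambda>x. a * f x + b * g x)"
      by (rule smooth_fun_lincomb[OF assms[THEN smooth_cpt_smooth_fun]])
    show "norm x \<le> max R S" if "a * f x + b * g x \<noteq> 0" for x
      using that R[of x] S[of x] by (cases "f x = 0") auto
  qed
qed

text \<open>Outside the closed ball \<open>f\<close> vanishes on an open set, so its derivative
  there is that of a constant.\<close>

lemma grad_eq_0_outside:
  fixes f :: "real ^ 'n \<Rightarrow> real"
  assumes "\<And>x. f x \<noteq> 0 \<Longrightarrow> norm x \<le> R" "(f has_derivative (\<lambda>v. a \<bullet> v)) (at x)" "R < norm x"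
  shows "a = 0"
proof -
  have "open {x :: real ^ 'n. R < norm x}" by (simp add: open_Collect_less continuous_on_norm_id)
  then have "((\<lambda>x. 0 :: real) has_derivative (\<lambda>v. a \<bullet> v)) (at x)"
    using assms by (intro has_derivative_transform_within_open[OF assms(2)]) (auto simp: not_le[symmetric])
  from has_derivative_unique[OF this has_derivative_const]
  have "a \<bullet> a = 0" by (rule fun_cong)
  then show ?thesis by simp
qed

lemma smooth_cpt_dderiv:
  assumes "smooth_cpt f"
  shows "smooth_cpt (\<lambda>x. frechet_derivative f (at x) v)"
proof -
  obtain R where R: "\<And>x. f x \<noteq> 0 \<Longrightarrow> norm x \<le> R" using smooth_cptE[OF assms] by blast
  note s = smooth_cpt_smooth_fun[OF assms]
  show ?thesis
  proof (rule smooth_cptI)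
    show "smooth_fun (\<lambda>x. frechet_derivative f (at x) v)" using s by (rule smooth_fun_dderiv1)
    show "norm x \<le> R" if "frechet_derivative f (at x) v \<noteq> 0" for x
      using grad_eq_0_outside[OF R has_derivative_grad[OF smooth_fun_differentiable[OF s, of x]]] that
        inner_grad[OF smooth_fun_differentiable[OF s, of x], of v] by (force simp: not_le[symmetric])
  qed
qed

lemma bounded_support_bounded:
  fixes f :: "real ^ 'n \<Rightarrow> 'b :: real_normed_vector"
  assumes "continuous_on UNIV f" "\<And>x. f x \<noteq> 0 \<Longrightarrow> norm x \<le> R"
  obtains B where "0 \<le> B" "\<And>x. norm (f x) \<le> B"
proof -
  have "compact (f ` cball 0 R)"
    using assms(1) by (intro compact_continuous_image continuous_on_subset[OF assms(1)]) auto
  then obtain B where B: "\<forall>y\<in>f ` cball 0 R. norm y \<le> B"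
    using compact_imp_bounded bounded_iff by metis
  show ?thesis
  proof (rule that[of "max B 0"])
    show "norm (f x) \<le> max B 0" for x
      using B assms(2)[of x] by (cases "f x = 0") (auto intro: max.coboundedI1)
  qed simp
qed

lemma smooth_cpt_bounded:
  assumes "smooth_cpt f"
  obtains B where "0 \<le> B" "\<And>x. \<bar>f x\<bar> \<le> B"
proof -
  obtain R where R: "\<And>x. f x \<noteq> 0 \<Longrightarrow> norm x \<le> R" using smooth_cptE[OF assms] by blast
  show ?thesis
    using bounded_support_bounded[OF smooth_fun_continuous[OF smooth_cpt_smooth_fun[OF assms]] R] that by auto
qed

lemma grad_nz_imp:
  assumes "smooth_cpt f" "\<And>x. f x \<noteq> 0 \<Longrightarrow> norm x \<le> R" "grad f x \<noteq> 0"
  shows "norm x \<le> R"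
  using grad_eq_0_outside[OF assms(2) has_derivative_grad[OF smooth_fun_differentiable[OF smooth_cpt_smooth_fun[OF assms(1)], of x]]] assms(3)
  by (force simp: not_le[symmetric])

lemma smooth_cpt_grad_bounded:
  assumes "smooth_cpt f"
  obtains B where "0 \<le> B" "\<And>x. norm (grad f x) \<le> B"
proof -
  obtain R where R: "\<And>x. f x \<noteq> 0 \<Longrightarrow> norm x \<le> R" using smooth_cptE[OF assms] by blast
  show ?thesis
    using bounded_support_bounded[OF continuous_on_grad[OF smooth_cpt_smooth_fun[OF assms]] grad_nz_imp[OF assms R]] that
    by blast
qed

lemma onorm_inner_le: "onorm (\<lambda>v. a \<bullet> v) \<le> norm a"
  by (rule onorm_bound) (auto simp: Cauchy_Schwarz_ineq2)

lemma smooth_cpt_lipschitz: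
  assumes "smooth_cpt f"
  obtains L where "0 \<le> L" "\<And>x y. \<bar>f x - f y\<bar> \<le> L * norm (x - y)"
proof -
  obtain L where L: "0 \<le> L" "\<And>x. norm (grad f x) \<le> L" using smooth_cpt_grad_bounded[OF assms] by blast
  have "norm (f x - f y) \<le> L * norm (x - y)" for x y
    by (rule differentiable_bound[where S = UNIV and f' = "\<lambda>x v. grad f x \<bullet> v"])
      (use L in \<open>auto intro!: has_derivative_grad smooth_fun_differentiable smooth_cpt_smooth_fun assms
        intro: order_trans[OF onorm_inner_le]\<close>)
  then show ?thesis using that L by simp
qed

text \<open>Each partial derivative is again a test function, hence Lipschitz; the constants of the
  components add up.\<close>

lemma smooth_cpt_grad_lipschitz:
  fixes f :: "real ^ 'n \<Rightarrow> real"
  assumes "smooth_cpt f"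
  obtains L where "0 \<le> L" "\<And>x y. norm (grad f x - grad f y) \<le> L * norm (x - y)"
proof -
  have "\<exists>L. 0 \<le> L \<and> (\<forall>x y. \<bar>grad f x $ i - grad f y $ i\<bar> \<le> L * norm (x - y))" for i
    using smooth_cpt_lipschitz[OF smooth_cpt_dderiv[OF assms, of "axis i 1"]] by (simp add: grad_def) metis
  then obtain L where L: "\<And>i. 0 \<le> L i" "\<And>i x y. \<bar>grad f x $ i - grad f y $ i\<bar> \<le> L i * norm (x - y)"
    by metis
  show ?thesis
  proof (rule that)
    show "0 \<le> (\<Sum>i\<in>UNIV. L i)" by (intro sum_nonneg L)
    fix x y
    have "norm (grad f x - grad f y) \<le> (\<Sum>i\<in>UNIV. \<bar>(grad f x - grad f y) $ i\<bar>)"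
      by (rule norm_le_l1_cart)
    also have "\<dots> \<le> (\<Sum>i\<in>UNIV. L i * norm (x - y))"
      by (intro sum_mono) (simp add: L)
    finally show "norm (grad f x - grad f y) \<le> (\<Sum>i\<in>UNIV. L i) * norm (x - y)"
      by (simp add: sum_distrib_right)
  qed
qed

text \<open>The mean value inequality is applied to \<open>f\<close> minus its linear part at
  \<open>x\<close>, whose gradient is at most \<open>L * norm h\<close> on the ball of radius
  \<open>norm h\<close>. Uniformity in \<open>x\<close> is what permits differentiation under the
  integral.\<close>

lemma smooth_cpt_taylor:
  assumes "smooth_cpt f"
  obtains C where "0 \<le> C" "\<And>x h. \<bar>f (x + h) - f x - grad f x \<bullet> h\<bar> \<le> C * (norm h)\<^sup>2"
proof -
  obtain L where L: "0 \<le> L" "\<And>x y. norm (grad f x - grad f y) \<le> L * norm (x - y)"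
    using smooth_cpt_grad_lipschitz[OF assms] by blast
  note der = has_derivative_grad[OF smooth_fun_differentiable[OF smooth_cpt_smooth_fun[OF assms]]]
  have "\<bar>f (x + h) - f x - grad f x \<bullet> h\<bar> \<le> L * (norm h)\<^sup>2" for x h
  proof -
    have "norm ((f (x + h) - grad f x \<bullet> (x + h)) - (f x - grad f x \<bullet> x)) \<le> (L * norm h) * norm (x + h - x)"
    proof (rule differentiable_bound[where S = "cball x (norm h)" and f' = "\<lambda>z v. (grad f z - grad f x) \<bullet> v"])
      fix z assume z: "z \<in> cball x (norm h)"
      show "((\<lambda>z. f z - grad f x \<bullet> z) has_derivative (\<lambda>v. (grad f z - grad f x) \<bullet> v)) (at z within cball x (norm h))"
        by (rule has_derivative_at_withinI, rule has_derivative_diff[OF der, THEN has_derivative_eq_rhs])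
          (auto intro!: derivative_eq_intros simp: inner_diff_left)
      have "norm (grad f z - grad f x) \<le> L * norm (z - x)" by (rule L)
      also have "\<dots> \<le> L * norm h" using z L(1) by (intro mult_left_mono) (auto simp: dist_norm norm_minus_commute)
      finally show "onorm (\<lambda>v. (grad f z - grad f x) \<bullet> v) \<le> L * norm h"
        using onorm_inner_le order_trans by blast
    qed (auto simp: dist_norm)
    then show ?thesis
      by (simp add: inner_add_right algebra_simps power2_eq_square)
  qed
  then show ?thesis using that L by blast
qed

lemma measurable_smooth_cpt:
  assumes "smooth_cpt f"
  shows "f \<in> borel_measurable borel" "grad f \<in> borel_measurable borel"
  by (rule borel_measurable_continuous_onI smooth_fun_continuous continuous_on_grad smooth_cpt_smooth_fun assms)+

lemma square_integrable_smooth_cpt: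
  assumes "smooth_cpt f"
  shows "square_integrable gauss f" "square_integrable gauss (grad f)"
proof -
  obtain B where "\<And>x. \<bar>f x\<bar> \<le> B" using smooth_cpt_bounded[OF assms] by blast
  then show "square_integrable gauss f"
    using measurable_smooth_cpt[OF assms] by (intro square_integrable_gauss_bounded) auto
  obtain B where "\<And>x. norm (grad f x) \<le> B" using smooth_cpt_grad_bounded[OF assms] by blast
  then show "square_integrable gauss (grad f)"
    using measurable_smooth_cpt[OF assms] by (intro square_integrable_gauss_bounded) auto
qed

section \<open>Differentiation of averages under the noise integral\<close>

lemma measurable_mix_noise [measurable]: "mix x \<in> borel_measurable noise"
  unfolding mix_def[abs_def] by measurable

lemma integrable_noise_bounded_mult:
  fixes \<psi> :: "real ^ 'n \<Rightarrow> 'b :: euclidean_space" and w :: "real \<times> (real ^ 'n) \<Rightarrow> real"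
  assumes [measurable]: "\<psi> \<in> borel_measurable borel" "w \<in> borel_measurable noise"
    and B: "\<And>x. norm (\<psi> x) \<le> B" "\<And>q. \<bar>w q\<bar> \<le> A"
  shows "integrable noise (\<lambda>q. w q *\<^sub>R \<psi> (mix x q))"
proof -
  have "0 \<le> A" using B(2)[of undefined] by linarith
  show ?thesis
  proof (rule noise.integrable_const_bound[where B = "A * B"])
    show "AE q in noise. norm (w q *\<^sub>R \<psi> (mix x q)) \<le> A * B"
      using B \<open>0 \<le> A\<close> by (intro AE_I2) (auto intro!: mult_mono)
  qed measurable
qed

text \<open>The chain rule through \<open>mix\<close> produces the factor
  \<open>cos (fst q)\<close>. Integrating the uniform quadratic Taylor remainder bounds the error of
  the averaged linearization directly.\<close>

lemma avg_has_derivative: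
  fixes w :: "real \<times> (real ^ 'n) \<Rightarrow> real"
  assumes \<psi>: "smooth_cpt \<psi>" and w [measurable]: "w \<in> borel_measurable noise" and A: "\<And>q. \<bar>w q\<bar> \<le> A"
  shows "(avg w \<psi> has_derivative (\<lambda>h. (\<integral>q. (w q * cos (fst q)) *\<^sub>R grad \<psi> (mix x q) \<partial>noise) \<bullet> h)) (at x)"
proof -
  note [measurable] = measurable_smooth_cpt[OF \<psi>]
  obtain B where B: "0 \<le> B" "\<And>x. \<bar>\<psi> x\<bar> \<le> B" using smooth_cpt_bounded[OF \<psi>] by blast
  obtain B' where B': "0 \<le> B'" "\<And>x. norm (grad \<psi> x) \<le> B'" using smooth_cpt_grad_bounded[OF \<psi>] by blast
  obtain C where C: "0 \<le> C" "\<And>x h. \<bar>\<psi> (x + h) - \<psi> x - grad \<psi> x \<bullet> h\<bar> \<le> C * (norm h)\<^sup>2"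
    using smooth_cpt_taylor[OF \<psi>] by blast
  have "0 \<le> A" using A[of undefined] by linarith
  have cA: "\<bar>w q * cos (fst q)\<bar> \<le> A" for q
    using mult_mono[OF A[of q] abs_cos_le_one[of "fst q"]] \<open>0 \<le> A\<close> by (simp add: abs_mult)
  define V where "V = (\<integral>q. (w q * cos (fst q)) *\<^sub>R grad \<psi> (mix x q) \<partial>noise)"
  have Vi: "integrable noise (\<lambda>q. (w q * cos (fst q)) *\<^sub>R grad \<psi> (mix x q))"
    by (rule integrable_noise_bounded_mult[OF _ _ B'(2) cA]) measurable
  have i: "integrable noise (\<lambda>q. w q * \<psi> (mix x q))" for x
    using integrable_noise_bounded_mult[of \<psi> w B A x] B A by simp
  \<comment> \<open>Weight bound times Taylor constant times the mass \<open>pi / 2\<close> of the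
    noise.\<close>
  define K where "K = A * C * (pi / 2)"
  have "0 \<le> K" using \<open>0 \<le> A\<close> C by (simp add: K_def)
  have bound: "\<bar>avg w \<psi> y - avg w \<psi> x - V \<bullet> (y - x)\<bar> \<le> K * (norm (y - x))\<^sup>2" for y
  proof -
    define r where "r q = w q * \<psi> (mix y q) - w q * \<psi> (mix x q) - ((w q * cos (fst q)) *\<^sub>R grad \<psi> (mix x q)) \<bullet> (y - x)" for q
    have "avg w \<psi> y - avg w \<psi> x - V \<bullet> (y - x) = (\<integral>q. r q \<partial>noise)"
    proof -
      have 1: "avg w \<psi> z = (\<integral>q. w q * \<psi> (mix z q) \<partial>noise)" for z
        by (simp add: avg_def mult.commute)
      have 2: "integrable noise (\<lambda>q. ((w q * cos (fst q)) *\<^sub>R grad \<psi> (mix x q)) \<bullet> (y - x))"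
        by (rule integrable_inner_left) (rule Vi)
      have 3: "V \<bullet> (y - x) = (\<integral>q. ((w q * cos (fst q)) *\<^sub>R grad \<psi> (mix x q)) \<bullet> (y - x) \<partial>noise)"
        unfolding V_def by (rule integral_inner_left[symmetric]) (rule Vi)
      show ?thesis
        unfolding 1 3 r_def
        by (simp only: Bochner_Integration.integral_diff Bochner_Integration.integrable_diff i 2)
    qed
    also have "\<bar>\<dots>\<bar> \<le> (\<integral>q. \<bar>r q\<bar> \<partial>noise)" by (rule integral_abs_bound)
    also have "\<dots> \<le> (\<integral>q. A * (C * (norm (y - x))\<^sup>2) \<partial>(noise :: (real \<times> (real ^ 'n)) measure))"
    proof (rule integral_mono)
      show "integrable noise (\<lambda>q. \<bar>r q\<bar>)"
        unfolding r_def using i[of x] i[of y] Vi by (intro integrable_abs Bochner_Integration.integrable_diff integrable_inner_left)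
      fix q :: "real \<times> (real ^ 'n)"
      define h where "h = cos (fst q) *\<^sub>R (y - x)"
      have my: "mix y q = mix x q + h" by (simp add: mix_def h_def algebra_simps)
      have "r q = w q * (\<psi> (mix x q + h) - \<psi> (mix x q) - grad \<psi> (mix x q) \<bullet> h)"
        unfolding r_def my by (simp add: h_def algebra_simps)
      also have "\<bar>\<dots>\<bar> \<le> A * (C * (norm h)\<^sup>2)"
        unfolding abs_mult using A C \<open>0 \<le> A\<close> by (intro mult_mono) auto
      also have "(norm h)\<^sup>2 \<le> (norm (y - x))\<^sup>2"
        by (intro power_mono) (auto simp: h_def mult_left_le_one_le)
      finally show "\<bar>r q\<bar> \<le> A * (C * (norm (y - x))\<^sup>2)"
        using \<open>0 \<le> A\<close> C by (meson mult_left_mono order_trans)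
    qed simp
    also have "\<dots> = K * (norm (y - x))\<^sup>2"
      by (simp add: K_def space_pair_measure measure_noise)
    finally show ?thesis .
  qed
  show ?thesis
    unfolding V_def[symmetric] has_derivative_at_alt
  proof (intro conjI allI impI)
    show "bounded_linear (\<lambda>h. V \<bullet> h)" by (rule bounded_linear_inner_right)
    fix e :: real assume "0 < e"
    show "\<exists>d>0. \<forall>y. norm (y - x) < d \<longrightarrow> norm (avg w \<psi> y - avg w \<psi> x - V \<bullet> (y - x)) \<le> e * norm (y - x)"
    \<comment> \<open>The constant \<open>K\<close> may be 0, hence the division by
      \<open>K + 1\<close>.\<close>
    proof (intro exI[of _ "e / (K + 1)"] conjI allI impI)
      show "0 < e / (K + 1)" using \<open>0 < e\<close> \<open>0 \<le> K\<close> by simp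
      fix y assume "norm (y - x) < e / (K + 1)"
      then have "norm (y - x) * (K + 1) < e" using \<open>0 \<le> K\<close> by (simp add: field_simps)
      moreover have "K * norm (y - x) \<le> norm (y - x) * (K + 1)" by (simp add: algebra_simps)
      ultimately have "K * norm (y - x) \<le> e" by linarith
      then have "K * norm (y - x) * norm (y - x) \<le> e * norm (y - x)"
        by (rule mult_right_mono) simp
      with bound[of y] show "norm (avg w \<psi> y - avg w \<psi> x - V \<bullet> (y - x)) \<le> e * norm (y - x)"
        by (simp add: power2_eq_square)
    qed
  qed
qed

text \<open>A directional derivative of an average is the average of a directional derivative, with
  the weight multiplied by \<open>cos (fst q)\<close>. The bound \<open>A\<close> survives this, so
  bounded-weight averages of test functions form an invariant class.\<close>

lemma smooth_fun_avg:
  fixes w :: "real \<times> (real ^ 'n) \<Rightarrow> real"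
  assumes "smooth_cpt \<psi>" "w \<in> borel_measurable noise" "\<And>q. \<bar>w q\<bar> \<le> A"
  shows "smooth_fun (avg w \<psi>)"
proof (rule smooth_fun_coinduct[where P = "\<lambda>f. \<exists>w \<psi>. smooth_cpt \<psi> \<and> w \<in> borel_measurable noise \<and> (\<forall>q. \<bar>w q\<bar> \<le> A) \<and> f = avg w \<psi>"])
  show "\<exists>w' \<psi>'. smooth_cpt \<psi>' \<and> w' \<in> borel_measurable noise \<and> (\<forall>q. \<bar>w' q\<bar> \<le> A) \<and> avg w \<psi> = avg w' \<psi>'"
    using assms by blast
next
  fix f :: "real ^ 'n \<Rightarrow> real" and x
  assume "\<exists>w \<psi>. smooth_cpt \<psi> \<and> w \<in> borel_measurable noise \<and> (\<forall>q. \<bar>w q\<bar> \<le> A) \<and> f = avg w \<psi>"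
  then show "f differentiable (at x)"
    using avg_has_derivative differentiable_def by blast
next
  fix f :: "real ^ 'n \<Rightarrow> real" and v
  assume "\<exists>w \<psi>. smooth_cpt \<psi> \<and> w \<in> borel_measurable noise \<and> (\<forall>q. \<bar>w q\<bar> \<le> A) \<and> f = avg w \<psi>"
  then obtain w \<psi> where \<psi>: "smooth_cpt \<psi>" and w [measurable]: "w \<in> borel_measurable noise"
    and A: "\<And>q. \<bar>w q\<bar> \<le> A" and f: "f = avg w \<psi>"
    by blast
  note [measurable] = measurable_smooth_cpt[OF \<psi>]
  obtain B' where B': "0 \<le> B'" "\<And>x. norm (grad \<psi> x) \<le> B'" using smooth_cpt_grad_bounded[OF \<psi>] by blast
  have "0 \<le> A" using A[of undefined] by linarith
  have cA: "\<bar>w q * cos (fst q)\<bar> \<le> A" for q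
    using mult_mono[OF A[of q] abs_cos_le_one[of "fst q"]] \<open>0 \<le> A\<close> by (simp add: abs_mult)
  have Vi: "integrable noise (\<lambda>q. (w q * cos (fst q)) *\<^sub>R grad \<psi> (mix x q))" for x
    by (rule integrable_noise_bounded_mult[OF _ _ B'(2) cA]) measurable
  have "frechet_derivative f (at x) v = avg (\<lambda>q. w q * cos (fst q)) (\<lambda>x. frechet_derivative \<psi> (at x) v) x" for x
    unfolding f has_derivative_inner_unique(2)[OF avg_has_derivative[OF \<psi> w A]] avg_def
    by (subst integral_inner_left[OF Vi, symmetric])
      (simp add: inner_grad[OF smooth_fun_differentiable[OF smooth_cpt_smooth_fun[OF \<psi>]]] mult_ac)
  then show "\<exists>w \<psi>. smooth_cpt \<psi> \<and> w \<in> borel_measurable noise \<and> (\<forall>q. \<bar>w q\<bar> \<le> A) \<and>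
      (\<lambda>x. frechet_derivative f (at x) v) = avg w \<psi>"
    using cA smooth_cpt_dderiv[OF \<psi>, of v]
    by (intro exI[of _ "\<lambda>q. w q * cos (fst q)"] exI[of _ "\<lambda>x. frechet_derivative \<psi> (at x) v"]) auto
qed

section \<open>Gaussian integration by parts\<close>

lemma integrable_lborel_bounded_support:
  fixes f :: "real ^ 'n \<Rightarrow> 'b :: euclidean_space"
  assumes "continuous_on UNIV f" "\<And>x. f x \<noteq> 0 \<Longrightarrow> norm x \<le> R"
  shows "integrable lborel f"
proof -
  have "integrable lborel (\<lambda>x. indicator (cball 0 R) x *\<^sub>R f x)"
    by (rule borel_integrable_compact) (use assms(1) in \<open>auto intro: continuous_on_subset\<close>)
  moreover have "(\<lambda>x. indicator (cball 0 R) x *\<^sub>R f x) = f"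
    using assms(2) by (force simp: indicator_def)
  ultimately show ?thesis by simp
qed

text \<open>Translation invariance of Lebesgue measure makes every difference quotient integrate to
  0, and dominated convergence passes to the derivative.\<close>

lemma integral_directional_derivative_eq_0:
  fixes h :: "real ^ 'n \<Rightarrow> real"
  assumes der: "\<And>x. (h has_derivative (\<lambda>v. D x \<bullet> v)) (at x)" and D: "continuous_on UNIV D"
    and R: "\<And>x. h x \<noteq> 0 \<Longrightarrow> norm x \<le> R"
  shows "(\<integral>x. D x \<bullet> e \<partial>lborel) = 0"
proof -
  have h: "continuous_on UNIV h"
    using der by (intro continuous_at_imp_continuous_on) (blast intro: has_derivative_continuous)
  have [measurable]: "h \<in> borel_measurable borel" "D \<in> borel_measurable borel"
    using h D by (auto intro: borel_measurable_continuous_onI)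
  have DR: "norm x \<le> R" if "D x \<noteq> 0" for x
    using grad_eq_0_outside[OF R der] that by (force simp: not_le[symmetric])
  obtain B where B: "0 \<le> B" "\<And>x. norm (D x) \<le> B"
    using bounded_support_bounded[OF D DR] by blast
  have lip: "\<bar>h x - h y\<bar> \<le> B * norm (x - y)" for x y
    using differentiable_bound[of UNIV h "\<lambda>x v. D x \<bullet> v" B x y] der
      order_trans[OF onorm_inner_le B(2)] by auto
  have hi: "integrable lborel h" using h R by (rule integrable_lborel_bounded_support)
  define d where "d k = e /\<^sub>R real (Suc k)" for k
  define q where "q k x = real (Suc k) * (h (x + d k) - h x)" for k x
  have hi': "integrable lborel (\<lambda>x. h (x + c))" and hI: "(\<integral>x. h (x + c) \<partial>lborel) = (\<integral>x. h x \<partial>lborel)" for c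
    using hi integrable_distr_eq[of "(+) c" lborel borel h] integral_distr[of "(+) c" lborel borel h]
    by (simp_all add: lborel_distr_plus add.commute)
  have q0: "(\<integral>x. q k x \<partial>lborel) = 0" for k
    unfolding q_def using hi hi' hI by simp
  have "(\<lambda>k. \<integral>x. q k x \<partial>lborel) \<longlonglongrightarrow> (\<integral>x. D x \<bullet> e \<partial>lborel)"
  proof (rule integral_dominated_convergence)
    \<comment> \<open>The shifts \<open>d k\<close> have norm at most \<open>norm e\<close>, so all
      quotients vanish outside the enlarged ball; the Lipschitz bound controls them inside.\<close>
    show "integrable lborel (\<lambda>x :: real ^ 'n. (B * norm e) * indicator (cball 0 (R + norm e)) x)"
      by (intro integrable_mult_right integrable_real_indicator) (use emeasure_bounded_finite[OF bounded_cball, of 0 "R + norm e"] in auto)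
    show "AE x in lborel. (\<lambda>k. q k x) \<longlonglongrightarrow> D x \<bullet> e"
    proof (rule AE_I2)
      fix x
      have "((\<lambda>t. h (x + t *\<^sub>R e)) has_derivative (\<lambda>s. D x \<bullet> (s *\<^sub>R e))) (at 0)"
      proof -
        have 1: "((\<lambda>t. x + t *\<^sub>R e) has_derivative (\<lambda>s. s *\<^sub>R e)) (at 0)"
          by (auto intro!: derivative_eq_intros)
        have 2: "(h has_derivative (\<lambda>v. D x \<bullet> v)) (at (x + 0 *\<^sub>R e))" using der by simp
        show ?thesis using has_derivative_compose[OF 1 2] by simp
      qed
      then have "((\<lambda>t. h (x + t *\<^sub>R e)) has_field_derivative (D x \<bullet> e)) (at 0)"
        unfolding has_field_derivative_def by (rule has_derivative_eq_rhs) (simp add: fun_eq_iff)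
      then have "((\<lambda>t. (h (x + t *\<^sub>R e) - h x) / t) \<longlongrightarrow> D x \<bullet> e) (at 0)"
        by (simp add: has_field_derivative_iff)
      moreover have "filterlim (\<lambda>k. inverse (real (Suc k))) (at 0) sequentially"
        using LIMSEQ_inverse_real_of_nat by (intro filterlim_atI) auto
      ultimately have "(\<lambda>k. (h (x + inverse (real (Suc k)) *\<^sub>R e) - h x) / inverse (real (Suc k))) \<longlonglongrightarrow> D x \<bullet> e"
        by (rule filterlim_compose)
      then show "(\<lambda>k. q k x) \<longlonglongrightarrow> D x \<bullet> e"
        by (simp add: q_def[abs_def] d_def divide_inverse mult.commute)
    qed
    show "AE x in lborel. norm (q k x) \<le> (B * norm e) * indicator (cball 0 (R + norm e)) x" for k
    proof (rule AE_I2)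
      fix x
      have nd: "real (Suc k) * norm (d k) = norm e" by (simp add: d_def field_simps)
      have "norm e \<le> real (Suc k) * norm e" by (simp add: mult_le_cancel_right1)
      then have nd2: "norm (d k) \<le> norm e" using nd by (simp add: d_def field_simps)
      show "norm (q k x) \<le> (B * norm e) * indicator (cball 0 (R + norm e)) x"
      proof (cases "norm x \<le> R + norm e")
        case True
        have "norm (q k x) = real (Suc k) * \<bar>h (x + d k) - h x\<bar>" by (simp add: q_def abs_mult)
        also have "\<dots> \<le> real (Suc k) * (B * norm (d k))"
          using lip[of "x + d k" x] by (intro mult_left_mono) auto
        also have "\<dots> = B * (real (Suc k) * norm (d k))" by simp
        also have "\<dots> = B * norm e" by (simp only: nd)
        finally show ?thesis using True by simp
      next
        case False
        have "norm x \<le> norm (x + d k) + norm (d k)"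
          using norm_triangle_ineq4[of "x + d k" "d k"] by simp
        then have "R < norm (x + d k)" "R < norm x"
          using False nd2 norm_ge_zero[of e] by linarith+
        then have "h (x + d k) = 0" "h x = 0" using R by (auto simp: not_le[symmetric])
        then show ?thesis using False by (simp add: q_def)
      qed
    qed
  qed (unfold q_def, measurable)
  then show ?thesis
    by (simp add: q0 LIMSEQ_const_iff)
qed

lemma gauss_dens_has_derivative:
  fixes x :: "real ^ 'n"
  shows "(gauss_dens has_derivative (\<lambda>v. (- gauss_dens x *\<^sub>R x) \<bullet> v)) (at x)"
proof -
  have "((\<lambda>x :: real ^ 'n. (norm x)\<^sup>2) has_derivative (\<lambda>v. 2 * (x \<bullet> v))) (at x)"
    unfolding power2_norm_eq_inner
    by (auto intro!: derivative_eq_intros simp: inner_commute)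
  then show ?thesis
    unfolding gauss_dens_def[abs_def]
    by (auto intro!: derivative_eq_intros simp: algebra_simps)
qed

lemma integral_gauss:
  fixes f :: "real ^ 'n \<Rightarrow> 'b :: {banach, second_countable_topology}"
  assumes "f \<in> borel_measurable borel"
  shows "(\<integral>x. f x \<partial>gauss) = (\<integral>x. gauss_dens x *\<^sub>R f x \<partial>lborel)"
  unfolding gauss_def using assms by (intro integral_density) auto

text \<open>The vanishing integral is applied to \<open>gauss_dens x * f x\<close>; differentiating
  the density contributes the factor \<open>- x\<close>.\<close>

lemma gauss_integration_by_parts:
  fixes f :: "real ^ 'n \<Rightarrow> real"
  assumes der: "\<And>x. (f has_derivative (\<lambda>v. D x \<bullet> v)) (at x)" and D: "continuous_on UNIV D"
    and R: "\<And>x. f x \<noteq> 0 \<Longrightarrow> norm x \<le> R"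
  shows "(\<integral>x. D x \<bullet> e \<partial>gauss) = (\<integral>x. f x * (x \<bullet> e) \<partial>gauss)"
proof -
  have f: "continuous_on UNIV f"
    using der by (intro continuous_at_imp_continuous_on) (blast intro: has_derivative_continuous)
  note m = borel_measurable_continuous_onI[OF f] borel_measurable_continuous_onI[OF D]
  have DR: "norm x \<le> R" if "D x \<noteq> 0" for x
    using grad_eq_0_outside[OF R der] that by (force simp: not_le[symmetric])
  have "((\<lambda>x. gauss_dens x * f x) has_derivative
      (\<lambda>v. (gauss_dens x *\<^sub>R D x - (gauss_dens x * f x) *\<^sub>R x) \<bullet> v)) (at x)" for x
    by (rule has_derivative_eq_rhs[OF has_derivative_mult[OF gauss_dens_has_derivative der]])
      (simp add: algebra_simps fun_eq_iff)
  then have "(\<integral>x. (gauss_dens x *\<^sub>R D x - (gauss_dens x * f x) *\<^sub>R x) \<bullet> e \<partial>lborel) = 0"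
    by (rule integral_directional_derivative_eq_0[where R = R])
      (use R in \<open>auto intro!: continuous_intros D f\<close>)
  then have "(\<integral>x. gauss_dens x *\<^sub>R (D x \<bullet> e) - gauss_dens x *\<^sub>R (f x * (x \<bullet> e)) \<partial>lborel) = 0"
    by (simp add: inner_diff_left mult.assoc)
  moreover have "integrable lborel (\<lambda>x. gauss_dens x *\<^sub>R (D x \<bullet> e))"
    by (rule integrable_lborel_bounded_support[where R = R]) (auto intro!: continuous_intros D DR)
  moreover have "integrable lborel (\<lambda>x. gauss_dens x *\<^sub>R (f x * (x \<bullet> e)))"
    by (rule integrable_lborel_bounded_support[where R = R]) (use R in \<open>auto intro!: continuous_intros f\<close>)
  ultimately show ?thesis
    using m by (simp add: integral_gauss)
qed

text \<open>Integration by parts in \<open>y\<close> at fixed angle, where the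
  \<open>y\<close>-gradient of \<open>\<psi> (mix x (t, y))\<close> is \<open>sin t\<close> times
  that of \<open>\<psi>\<close>. The right-hand side is the gradient of \<open>res \<psi>\<close> by
  differentiation under the integral, so for test functions \<open>res_grad\<close> is a genuine
  gradient.\<close>

lemma res_grad_eq:
  fixes \<psi> :: "real ^ 'n \<Rightarrow> real"
  assumes \<psi>: "smooth_cpt \<psi>"
  shows "res_grad \<psi> x = (\<integral>q. (sin (fst q) * cos (fst q)) *\<^sub>R grad \<psi> (mix x q) \<partial>noise)"
proof -
  note [measurable] = measurable_smooth_cpt[OF \<psi>]
  obtain B where B: "0 \<le> B" "\<And>x. \<bar>\<psi> x\<bar> \<le> B" using smooth_cpt_bounded[OF \<psi>] by blast
  obtain B' where B': "0 \<le> B'" "\<And>x. norm (grad \<psi> x) \<le> B'" using smooth_cpt_grad_bounded[OF \<psi>] by blast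
  obtain R where R: "0 \<le> R" "\<And>x. \<psi> x \<noteq> 0 \<Longrightarrow> norm x \<le> R" using smooth_cptE[OF \<psi>] by blast
  have i1: "integrable noise (\<lambda>q. \<psi> (mix x q) *\<^sub>R (cos (fst q) *\<^sub>R snd q))"
    by (rule integrable_scaleR_square_integrable[OF square_integrable_noise_bounded square_integrable_res_grad_weight])
      (use B in auto)
  have i2: "integrable noise (\<lambda>q. (sin (fst q) * cos (fst q)) *\<^sub>R grad \<psi> (mix x q))"
    by (rule integrable_noise_bounded_mult[where A = 1, OF _ _ B'(2)]) (auto simp: abs_mult mult_le_one)
  show ?thesis
  proof (rule vector_eq_ldot[THEN iffD1, rule_format])
    fix e :: "real ^ 'n"
    have j1: "integrable noise (\<lambda>q. cos (fst q) * (\<psi> (mix x q) * (snd q \<bullet> e)))"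
      using integrable_inner_left[OF i1, of e] by (simp add: mult_ac)
    have j2: "integrable noise (\<lambda>q. cos (fst q) * ((sin (fst q) *\<^sub>R grad \<psi> (mix x q)) \<bullet> e))"
      using integrable_inner_left[OF i2, of e] by (simp add: mult_ac)
    have "res_grad \<psi> x \<bullet> e = (\<integral>q. (\<psi> (mix x q) *\<^sub>R (cos (fst q) *\<^sub>R snd q)) \<bullet> e \<partial>noise)"
      unfolding res_grad_def avg_def by (rule integral_inner_left[symmetric]) (rule i1)
    also have "\<dots> = (\<integral>q. cos (fst q) * (\<psi> (mix x q) * (snd q \<bullet> e)) \<partial>noise)"
      by (intro Bochner_Integration.integral_cong refl) (simp add: mult_ac)
    also have "\<dots> = (\<integral>t. \<integral>y. cos t * (\<psi> (mix x (t, y)) * (y \<bullet> e)) \<partial>gauss \<partial>angle)"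
      by (subst angle_gauss.integral_fst'[OF j1, symmetric]) simp
    also have "\<dots> = (\<integral>t. \<integral>y. cos t * ((sin t *\<^sub>R grad \<psi> (mix x (t, y))) \<bullet> e) \<partial>gauss \<partial>angle)"
    proof (rule integral_cong_AE)
      show "AE t in angle. (\<integral>y. cos t * (\<psi> (mix x (t, y)) * (y \<bullet> e)) \<partial>gauss) =
          (\<integral>y. cos t * ((sin t *\<^sub>R grad \<psi> (mix x (t, y))) \<bullet> e) \<partial>gauss)"
        using AE_angle
      proof eventually_elim
        case (elim t)
        then have s: "0 < sin t" by (intro sin_gt_zero) auto
        have "(\<integral>y. (sin t *\<^sub>R grad \<psi> (mix x (t, y))) \<bullet> e \<partial>gauss) = (\<integral>y. \<psi> (mix x (t, y)) * (y \<bullet> e) \<partial>gauss)"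
        proof (rule gauss_integration_by_parts)
          fix y
          have 1: "((\<lambda>y. mix x (t, y)) has_derivative (\<lambda>v. sin t *\<^sub>R v)) (at y)"
            unfolding mix_def by (auto intro!: derivative_eq_intros)
          have 2: "(\<psi> has_derivative (\<lambda>v. grad \<psi> (mix x (t, y)) \<bullet> v)) (at (mix x (t, y)))"
            by (intro has_derivative_grad smooth_fun_differentiable smooth_cpt_smooth_fun \<psi>)
          show "((\<lambda>y. \<psi> (mix x (t, y))) has_derivative (\<lambda>v. (sin t *\<^sub>R grad \<psi> (mix x (t, y))) \<bullet> v)) (at y)"
            using has_derivative_compose[OF 1 2] by simp
          assume "\<psi> (mix x (t, y)) \<noteq> 0"
          then have le: "norm (mix x (t, y)) \<le> R" by (rule R(2))
          have "sin t * norm y = norm (mix x (t, y) - cos t *\<^sub>R x)"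
            using s by (simp add: mix_def)
          also have "\<dots> \<le> norm (mix x (t, y)) + norm (cos t *\<^sub>R x)" by (rule norm_triangle_ineq4)
          also have "\<dots> \<le> R + norm x" using le by (intro add_mono) (auto simp: mult_left_le_one_le)
          \<comment> \<open>The radius is finite because \<open>sin t\<close> is positive; at angle
            0 the function does not depend on \<open>y\<close> at all, which is why only almost
            every angle is treated.\<close>
          finally show "norm y \<le> (R + norm x) / sin t" using s by (simp add: field_simps)
        next
          have "continuous_on UNIV (grad \<psi>)"
            by (intro continuous_on_grad smooth_cpt_smooth_fun \<psi>)
          then show "continuous_on UNIV (\<lambda>y. sin t *\<^sub>R grad \<psi> (mix x (t, y)))"
            unfolding mix_def by (auto intro!: continuous_intros intro: continuous_on_compose2)
        qed
        then show ?case by simp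
      qed
    qed (rule borel_measurable_integrable angle_gauss.integrable_fst' j1[THEN angle_gauss.integrable_fst', simplified fst_conv snd_conv] j2[THEN angle_gauss.integrable_fst', simplified fst_conv snd_conv])+
    also have "\<dots> = (\<integral>q. cos (fst q) * ((sin (fst q) *\<^sub>R grad \<psi> (mix x q)) \<bullet> e) \<partial>noise)"
      by (subst angle_gauss.integral_fst'[OF j2, symmetric]) simp
    also have "\<dots> = (\<integral>q. ((sin (fst q) * cos (fst q)) *\<^sub>R grad \<psi> (mix x q)) \<bullet> e \<partial>noise)"
      by (intro Bochner_Integration.integral_cong refl) (simp add: mult_ac)
    also have "\<dots> = (\<integral>q. (sin (fst q) * cos (fst q)) *\<^sub>R grad \<psi> (mix x q) \<partial>noise) \<bullet> e"
      by (rule integral_inner_left) (rule i2)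
    finally show "e \<bullet> res_grad \<psi> x = e \<bullet> (\<integral>q. (sin (fst q) * cos (fst q)) *\<^sub>R grad \<psi> (mix x q) \<partial>noise)"
      by (simp add: inner_commute)
  qed
qed

text \<open>Changing the weight costs its \<open>L\<^sup>1\<close> distance, uniformly in
  \<open>x\<close>. The factor \<open>c\<close> will be 1 for the function and the chain rule cosine
  for its gradient.\<close>

lemma norm_integral_weight_diff_le:
  fixes \<psi> :: "real ^ 'n \<Rightarrow> 'b :: euclidean_space" and v w :: "real \<times> (real ^ 'n) \<Rightarrow> real"
  assumes [measurable]: "\<psi> \<in> borel_measurable borel" "v \<in> borel_measurable noise" "w \<in> borel_measurable noise"
    and B: "\<And>x. norm (\<psi> x) \<le> B" "\<And>q. \<bar>v q\<bar> \<le> A" "\<And>q. \<bar>w q\<bar> \<le> A" and c: "\<And>q. \<bar>c q\<bar> \<le> 1"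
    and [measurable]: "c \<in> borel_measurable noise"
  shows "norm ((\<integral>q. (v q * c q) *\<^sub>R \<psi> (mix x q) \<partial>noise) - (\<integral>q. (w q * c q) *\<^sub>R \<psi> (mix x q) \<partial>noise))
    \<le> B * (\<integral>q. \<bar>v q - w q\<bar> \<partial>noise)"
proof -
  have "0 \<le> A" "0 \<le> B" using B(1)[of undefined] B(2)[of undefined] norm_ge_zero order_trans abs_ge_zero by blast+
  have v: "\<bar>v q * c q\<bar> \<le> A" and w: "\<bar>w q * c q\<bar> \<le> A" for q
    using mult_mono[OF B(2)[of q] c[of q]] mult_mono[OF B(3)[of q] c[of q]] \<open>0 \<le> A\<close> by (simp_all add: abs_mult)
  have i: "integrable noise (\<lambda>q. (v q * c q) *\<^sub>R \<psi> (mix x q))" "integrable noise (\<lambda>q. (w q * c q) *\<^sub>R \<psi> (mix x q))"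
    by (rule integrable_noise_bounded_mult[OF _ _ B(1)], measurable, rule v w)+
  have vw: "integrable noise (\<lambda>q. B * \<bar>v q - w q\<bar>)"
  proof -
    have "integrable noise v" "integrable noise w"
      by (rule noise.integrable_const_bound[where B = A]; use B in simp)+
    then show ?thesis by (intro integrable_mult_right integrable_abs Bochner_Integration.integrable_diff)
  qed
  have "norm ((\<integral>q. (v q * c q) *\<^sub>R \<psi> (mix x q) \<partial>noise) - (\<integral>q. (w q * c q) *\<^sub>R \<psi> (mix x q) \<partial>noise)) =
      norm (\<integral>q. (v q * c q) *\<^sub>R \<psi> (mix x q) - (w q * c q) *\<^sub>R \<psi> (mix x q) \<partial>noise)"
    by (simp only: Bochner_Integration.integral_diff i)
  also have "\<dots> \<le> (\<integral>q. norm ((v q * c q) *\<^sub>R \<psi> (mix x q) - (w q * c q) *\<^sub>R \<psi> (mix x q)) \<partial>noise)"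
    by (rule integral_norm_bound)
  also have "\<dots> \<le> (\<integral>q. B * \<bar>v q - w q\<bar> \<partial>noise)"
  proof (rule integral_mono)
    fix q :: "real \<times> (real ^ 'n)"
    have "norm ((v q * c q) *\<^sub>R \<psi> (mix x q) - (w q * c q) *\<^sub>R \<psi> (mix x q)) = \<bar>v q - w q\<bar> * \<bar>c q\<bar> * norm (\<psi> (mix x q))"
      unfolding scaleR_diff_left[symmetric] left_diff_distrib[symmetric] by (simp add: abs_mult)
    also have "\<dots> \<le> \<bar>v q - w q\<bar> * 1 * B"
      using B c \<open>0 \<le> B\<close> by (intro mult_mono) auto
    finally show "norm ((v q * c q) *\<^sub>R \<psi> (mix x q) - (w q * c q) *\<^sub>R \<psi> (mix x q)) \<le> B * \<bar>v q - w q\<bar>"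
      by (simp add: mult.commute)
  qed (intro integrable_norm Bochner_Integration.integrable_diff i vw)+
  finally show ?thesis by simp
qed

lemma integral_gauss_power2_le:
  fixes f :: "real ^ 'n \<Rightarrow> 'b :: euclidean_space"
  assumes "f \<in> borel_measurable borel" "\<And>x. norm (f x) \<le> b"
  shows "(\<integral>x. (norm (f x))\<^sup>2 \<partial>gauss) \<le> b\<^sup>2"
proof -
  have "(\<integral>x. (norm (f x))\<^sup>2 \<partial>gauss) \<le> (\<integral>x. b\<^sup>2 \<partial>(gauss :: (real ^ 'n) measure))"
    using square_integrable_gauss_bounded[OF assms] assms
    by (intro integral_mono square_integrable_norm_power2) (auto intro!: power_mono)
  then show ?thesis by (simp add: gauss.prob_space[simplified])
qed

text \<open>Truncating the noise keeps the average compactly supported.\<close>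
lemma H1_gauss_res_smooth:
  fixes \<psi> :: "real ^ 'n \<Rightarrow> real"
  assumes \<psi>: "smooth_cpt \<psi>"
  shows "H1_gauss (res \<psi>) (res_grad \<psi>)"
proof -
  note [measurable] = measurable_smooth_cpt[OF \<psi>]
  obtain B where B: "0 \<le> B" "\<And>x. \<bar>\<psi> x\<bar> \<le> B" using smooth_cpt_bounded[OF \<psi>] by blast
  obtain B' where B': "0 \<le> B'" "\<And>x. norm (grad \<psi> x) \<le> B'" using smooth_cpt_grad_bounded[OF \<psi>] by blast
  obtain R where R: "0 \<le> R" "\<And>x. \<psi> x \<noteq> 0 \<Longrightarrow> norm x \<le> R" using smooth_cptE[OF \<psi>] by blast
  \<comment> \<open>Two cut-offs: bounded noise, and angles away from \<open>pi / 2\<close>, where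
    \<open>mix x q\<close> loses its dependence on \<open>x\<close>. Every \<open>q\<close> with
    \<open>cos (fst q) > 0\<close> eventually belongs to \<open>T k\<close>.\<close>
  define T :: "nat \<Rightarrow> (real \<times> (real ^ 'n)) set" where
    "T k = {q. inverse (real (Suc k)) \<le> cos (fst q) \<and> norm (snd q) \<le> real k}" for k
  define w where "w k q = indicator (T k) q * sin (fst q)" for k q
  have [measurable]: "w k \<in> borel_measurable noise" for k
    unfolding w_def T_def indicator_def by measurable
  have w1: "\<bar>w k q\<bar> \<le> 1" for k q by (auto simp: w_def indicator_def)
  define \<phi> where "\<phi> k = avg (w k) \<psi>" for k
  define \<epsilon> where "\<epsilon> k = (\<integral>q. \<bar>w k q - sin (fst q)\<bar> \<partial>(noise :: (real \<times> (real ^ 'n)) measure))" for k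
  have \<epsilon>: "\<epsilon> \<longlonglongrightarrow> 0"
  proof -
    have "\<epsilon> \<longlonglongrightarrow> (\<integral>q. 0 \<partial>(noise :: (real \<times> (real ^ 'n)) measure))"
      unfolding \<epsilon>_def[abs_def]
    proof (rule integral_dominated_convergence)
      show "integrable noise (\<lambda>q :: real \<times> (real ^ 'n). 1 :: real)" by simp
      show "AE q in noise. (\<lambda>k. \<bar>w k q - sin (fst q)\<bar>) \<longlonglongrightarrow> 0"
        using AE_noise
      proof eventually_elim
        case (elim q)
        have "0 < cos (fst q)" using elim by (intro cos_gt_zero) auto
        then have "eventually (\<lambda>k. inverse (real (Suc k)) < cos (fst q)) sequentially"
          using order_tendstoD(2)[OF LIMSEQ_inverse_real_of_nat] by blast
        moreover have "eventually (\<lambda>k. norm (snd q) \<le> real k) sequentially"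
          by (rule eventually_sequentiallyI[of "nat \<lceil>norm (snd q)\<rceil>"]) linarith
        ultimately have "eventually (\<lambda>k. \<bar>w k q - sin (fst q)\<bar> = 0) sequentially"
          by eventually_elim (simp add: w_def T_def)
        then show ?case by (rule tendsto_eventually)
      qed
      show "AE q in noise. norm \<bar>w k q - sin (fst q)\<bar> \<le> 1" for k
        by (rule AE_I2) (auto simp: w_def indicator_def)
    qed measurable
    then show ?thesis by simp
  qed
  have cpt: "smooth_cpt (\<phi> k)" for k
  proof (rule smooth_cptI)
    show "smooth_fun (\<phi> k)"
      unfolding \<phi>_def by (rule smooth_fun_avg[OF \<psi> _ w1]) measurable
    fix x assume "\<phi> k x \<noteq> 0"
    \<comment> \<open>A nonzero average has a nonzero integrand somewhere; solving
      \<open>mix x q\<close> for \<open>x\<close> at such a \<open>q\<close> bounds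
      \<open>x\<close>.\<close>
    then obtain q where q: "\<psi> (mix x q) *\<^sub>R w k q \<noteq> 0"
      unfolding \<phi>_def avg_def by (metis (mono_tags, lifting) integral_zero Bochner_Integration.integral_cong)
    then have "norm (mix x q) \<le> R" and T: "inverse (real (Suc k)) \<le> cos (fst q)" "norm (snd q) \<le> real k"
      using R(2) by (auto simp: w_def T_def indicator_def split: if_splits)
    have "0 < inverse (real (Suc k))" by simp
    then have c: "0 < cos (fst q)" using T(1) by linarith
    have "cos (fst q) * norm x = norm (mix x q - sin (fst q) *\<^sub>R snd q)"
      using c by (simp add: mix_def)
    also have "\<dots> \<le> norm (mix x q) + norm (sin (fst q) *\<^sub>R snd q)" by (rule norm_triangle_ineq4)
    also have "norm (sin (fst q) *\<^sub>R snd q) \<le> norm (snd q)" by (simp add: mult_left_le_one_le)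
    finally have "cos (fst q) * norm x \<le> R + real k" using \<open>norm (mix x q) \<le> R\<close> T(2) by linarith
    moreover have "inverse (real (Suc k)) * norm x \<le> cos (fst q) * norm x"
      using T(1) by (intro mult_right_mono) auto
    ultimately have "inverse (real (Suc k)) * norm x \<le> R + real k" by linarith
    then show "norm x \<le> real (Suc k) * (R + real k)" by (simp add: field_simps)
  qed
  have d0: "\<bar>\<phi> k x - res \<psi> x\<bar> \<le> B * \<epsilon> k" for k x
    using norm_integral_weight_diff_le[of \<psi> "w k" "\<lambda>q. sin (fst q)" B 1 "\<lambda>_. 1" x] B w1
    by (simp add: \<phi>_def res_def avg_def \<epsilon>_def mult.commute)
  have grad_\<phi>: "grad (\<phi> k) x = (\<integral>q. (w k q * cos (fst q)) *\<^sub>R grad \<psi> (mix x q) \<partial>noise)" for k x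
    unfolding \<phi>_def by (rule has_derivative_inner_unique(1)[OF avg_has_derivative[OF \<psi> _ w1]]) measurable
  have d1: "norm (grad (\<phi> k) x - res_grad \<psi> x) \<le> B' * \<epsilon> k" for k x
    using norm_integral_weight_diff_le[of "grad \<psi>" "w k" "\<lambda>q. sin (fst q)" B' 1 "\<lambda>q. cos (fst q)" x] B' w1
    unfolding grad_\<phi> res_grad_eq[OF \<psi>] by (simp add: \<epsilon>_def)
  note s = square_integrable_res[OF square_integrable_smooth_cpt(1)[OF \<psi>]]
    square_integrable_res_grad[OF square_integrable_smooth_cpt(1)[OF \<psi>]]
  have m: "res \<psi> \<in> borel_measurable borel" "res_grad \<psi> \<in> borel_measurable borel"
    using s[THEN square_integrable_measurable] by simp_all
  \<comment> \<open>The bounds \<open>d0\<close> and \<open>d1\<close> are uniform in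
    \<open>x\<close>, and \<open>gauss\<close> is a probability measure, so they control the
    \<open>L\<^sup>2\<close> norms.\<close>
  have "(\<lambda>k. \<integral>x. (\<phi> k x - res \<psi> x)\<^sup>2 \<partial>gauss) \<longlonglongrightarrow> 0"
  proof (rule tendsto_sandwich[where f = "\<lambda>_. 0" and h = "\<lambda>k. (B * \<epsilon> k)\<^sup>2"])
    show "\<forall>\<^sub>F k in sequentially. (\<integral>x. (\<phi> k x - res \<psi> x)\<^sup>2 \<partial>gauss) \<le> (B * \<epsilon> k)\<^sup>2"
      using integral_gauss_power2_le[of "\<lambda>x. \<phi> k x - res \<psi> x" "B * \<epsilon> k" for k] d0 m measurable_smooth_cpt[OF cpt]
      by (intro always_eventually allI) simp
    show "(\<lambda>k. (B * \<epsilon> k)\<^sup>2) \<longlonglongrightarrow> 0" by (rule tendsto_eq_intros \<epsilon> refl)+ simp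
  qed auto
  moreover have "(\<lambda>k. \<integral>x. (norm (grad (\<phi> k) x - res_grad \<psi> x))\<^sup>2 \<partial>gauss) \<longlonglongrightarrow> 0"
  proof (rule tendsto_sandwich[where f = "\<lambda>_. 0" and h = "\<lambda>k. (B' * \<epsilon> k)\<^sup>2"])
    show "\<forall>\<^sub>F k in sequentially. (\<integral>x. (norm (grad (\<phi> k) x - res_grad \<psi> x))\<^sup>2 \<partial>gauss) \<le> (B' * \<epsilon> k)\<^sup>2"
      using integral_gauss_power2_le[of "\<lambda>x. grad (\<phi> k) x - res_grad \<psi> x" "B' * \<epsilon> k" for k] d1 m measurable_smooth_cpt[OF cpt]
      by (intro always_eventually allI) simp
    show "(\<lambda>k. (B' * \<epsilon> k)\<^sup>2) \<longlonglongrightarrow> 0" by (rule tendsto_eq_intros \<epsilon> refl)+ simp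
  qed auto
  ultimately show ?thesis
    unfolding H1_gauss_def using cpt s
    by (auto simp: square_integrable_def)
qed

section \<open>Density of test functions\<close>

text \<open>The classical flat function \<open>exp (- 1 / t)\<close> with its quotients by powers of
  \<open>t\<close>: differentiation maps the family into its own span, so all orders are handled at
  once.\<close>

definition bump :: "nat \<Rightarrow> real \<Rightarrow> real" where
  "bump j t = (if 0 < t then exp (- (1 / t)) / t ^ j else 0)"

lemma bump_nonneg: "0 \<le> bump j t"
  by (simp add: bump_def)

text \<open>From \<open>exp y \<ge> (y / n) ^ n\<close> at \<open>y = 1 / t\<close>. The exponent
  \<open>n = j + 2\<close> leaves two spare powers of \<open>t\<close>, so the difference quotient
  at 0 is of order \<open>t\<close>.\<close>

lemma bump_le_square: "bump j t \<le> real (j + 2) ^ (j + 2) * t\<^sup>2"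
proof (cases "0 < t")
  case True
  define n where "n = j + 2"
  have n: "0 < real n" by (simp add: n_def)
  have "1 / t / real n \<le> exp (1 / t / real n)"
    using exp_ge_add_one_self[of "1 / t / real n"] by linarith
  then have "(1 / t / real n) ^ n \<le> exp (1 / t / real n) ^ n"
    using True by (intro power_mono) auto
  also have "\<dots> = exp (1 / t)"
    by (rule exp_divide_power_eq) (simp add: n_def)
  finally have "exp (- (1 / t)) \<le> (real n * t) ^ n"
    using True n by (simp add: exp_minus field_simps power_divide)
  then have "bump j t \<le> (real n * t) ^ n / t ^ j"
    using True by (simp add: bump_def divide_right_mono)
  also have "\<dots> = real n ^ n * t\<^sup>2"
    using True by (simp add: n_def power_mult_distrib power_add power2_eq_square)
  finally show ?thesis by (simp add: n_def)
qed (simp add: bump_def)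

lemma bump_has_derivative:
  "(bump j has_real_derivative (bump (j + 2) t - real j * bump (j + 1) t)) (at t)"
proof -
  consider "t < 0" | "0 < t" | "t = 0" by linarith
  then show ?thesis
  proof cases
    case 1
    have "((\<lambda>_. 0) has_real_derivative 0) (at t)" by simp
    then have "(bump j has_real_derivative 0) (at t)"
      by (rule has_field_derivative_transform_within_open[where S = "{..<0}"]) (use 1 in \<open>auto simp: bump_def\<close>)
    then show ?thesis using 1 by (simp add: bump_def)
  next
    case 2
    have "((\<lambda>t. exp (- (1 / t)) / t ^ j) has_real_derivative (bump (j + 2) t - real j * bump (j + 1) t)) (at t)"
      using 2 by (auto intro!: derivative_eq_intros simp: bump_def)
        (cases j; simp add: field_simps power2_eq_square)
    then show ?thesis
      by (rule has_field_derivative_transform_within_open[where S = "{0<..}"]) (use 2 in \<open>auto simp: bump_def\<close>)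
  next
    case 3
    define C where "C = real (j + 2) ^ (j + 2)"
    have "((\<lambda>h. bump j h / h) \<longlongrightarrow> 0) (at 0)"
    proof (rule Lim_null_comparison)
      show "\<forall>\<^sub>F h in at 0. norm (bump j h / h) \<le> C * \<bar>h\<bar>"
      proof (rule always_eventually, rule allI)
        fix h
        show "norm (bump j h / h) \<le> C * \<bar>h\<bar>"
          using bump_le_square[of j h, folded C_def] bump_nonneg[of j h]
          by (cases "h = 0") (simp_all add: divide_le_eq power2_eq_square mult.assoc)
      qed
      show "((\<lambda>h. C * \<bar>h\<bar>) \<longlongrightarrow> 0) (at 0)" by (auto intro!: tendsto_eq_intros)
    qed
    then show ?thesis
      using 3 by (simp add: has_field_derivative_iff bump_def[of _ 0])
  qed
qed

text \<open>Rich enough for smooth cut-offs of boxes, and stable under differentiation because every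
  \<open>bump j\<close> is included and products are allowed.\<close>

inductive bump_algebra :: "(real ^ 'n \<Rightarrow> real) \<Rightarrow> bool" where
  const: "bump_algebra (\<lambda>x. c)"
| coord: "bump_algebra (\<lambda>x. bump j (c * x $ i + d))"
| add: "bump_algebra f \<Longrightarrow> bump_algebra g \<Longrightarrow> bump_algebra (\<lambda>x. f x + g x)"
| mult: "bump_algebra f \<Longrightarrow> bump_algebra g \<Longrightarrow> bump_algebra (\<lambda>x. f x * g x)"

lemma bump_algebra_derivative:
  "bump_algebra f \<Longrightarrow> \<exists>D. (\<forall>x. (f has_derivative D x) (at x)) \<and> (\<forall>v. bump_algebra (\<lambda>x. D x v))"
proof (induction rule: bump_algebra.induct)
  case (const c)
  show ?case
    by (intro exI[of _ "\<lambda>x v. 0"]) (auto intro: bump_algebra.const)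
next
  case (coord j c i d)
  define D where "D x v = (bump (j + 2) (c * x $ i + d) + (- real j) * bump (j + 1) (c * x $ i + d)) * (c * v $ i)"
    for x v :: "real ^ 'a"
  have "((\<lambda>x. bump j (c * x $ i + d)) has_derivative D x) (at x)" for x :: "real ^ 'a"
  proof -
    have "((\<lambda>x :: real ^ 'a. c * x $ i + d) has_derivative (\<lambda>v. c * v $ i)) (at x)"
      by (auto intro!: derivative_eq_intros bounded_linear.has_derivative[OF bounded_linear_vec_nth])
    from has_derivative_compose[OF this bump_has_derivative[unfolded has_field_derivative_def]]
    show ?thesis
      by (rule has_derivative_eq_rhs) (auto simp: D_def fun_eq_iff)
  qed
  moreover have "bump_algebra (\<lambda>x. D x v)" for v
    unfolding D_def by (intro bump_algebra.intros)
  ultimately show ?case by blast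
next
  case (add f g)
  then obtain D E where "\<forall>x. (f has_derivative D x) (at x)" "\<forall>v. bump_algebra (\<lambda>x. D x v)"
    "\<forall>x. (g has_derivative E x) (at x)" "\<forall>v. bump_algebra (\<lambda>x. E x v)" by blast
  then show ?case
    by (intro exI[of _ "\<lambda>x v. D x v + E x v"]) (auto intro: bump_algebra.intros has_derivative_add)
next
  case (mult f g)
  then obtain D E where "\<forall>x. (f has_derivative D x) (at x)" "\<forall>v. bump_algebra (\<lambda>x. D x v)"
    "\<forall>x. (g has_derivative E x) (at x)" "\<forall>v. bump_algebra (\<lambda>x. E x v)" by blast
  moreover from this mult.hyps have "bump_algebra (\<lambda>x. f x * E x v + D x v * g x)" for v
    by (intro bump_algebra.add bump_algebra.mult) auto
  ultimately show ?case
    by (intro exI[of _ "\<lambda>x v. f x * E x v + D x v * g x"]) (auto intro: has_derivative_mult)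
qed

lemma smooth_fun_bump_algebra:
  assumes "bump_algebra f"
  shows "smooth_fun f"
proof (rule smooth_fun_coinduct[where P = bump_algebra])
  fix f :: "real ^ 'a \<Rightarrow> real" and v
  assume "bump_algebra f"
  then obtain D where D: "\<And>x. (f has_derivative D x) (at x)" "\<And>v. bump_algebra (\<lambda>x. D x v)"
    using bump_algebra_derivative by blast
  then show "f differentiable (at x)" for x
    unfolding differentiable_def by blast
  have "frechet_derivative f (at x) = D x" for x
    using frechet_derivative_at[OF D(1)] by simp
  then show "bump_algebra (\<lambda>x. frechet_derivative f (at x) v)"
    using D(2) by simp
qed fact

lemma bump_algebra_prod:
  "finite A \<Longrightarrow> (\<And>i. i \<in> A \<Longrightarrow> bump_algebra (f i)) \<Longrightarrow> bump_algebra (\<lambda>x. \<Prod>i\<in>A. f i x)"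
  by (induction A rule: finite_induct) (auto intro: bump_algebra.intros)

section \<open>The closure of the test functions in Gaussian \<open>L\<^sup>2\<close>\<close>

lemma square_integrable_dominated_convergence:
  fixes g :: "'a \<Rightarrow> real"
  assumes f: "\<And>k. f k \<in> borel_measurable M" and g: "g \<in> borel_measurable M" and h: "square_integrable M h"
    and lim: "AE x in M. (\<lambda>k. f k x) \<longlonglongrightarrow> g x" and bound: "\<And>k. AE x in M. \<bar>f k x\<bar> \<le> h x"
  shows "square_integrable M g" "(\<lambda>k. \<integral>x. (f k x - g x)\<^sup>2 \<partial>M) \<longlonglongrightarrow> 0"
proof -
  note [measurable] = f g square_integrable_measurable[OF h]
  have all: "AE x in M. \<forall>k. \<bar>f k x\<bar> \<le> h x" using bound by (simp add: AE_all_countable)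
  have gh: "AE x in M. \<bar>g x\<bar> \<le> h x"
    using lim all
  proof eventually_elim
    case (elim x)
    then have "(\<lambda>k. \<bar>f k x\<bar>) \<longlonglongrightarrow> \<bar>g x\<bar>" by (intro tendsto_rabs)
    then show ?case by (rule LIMSEQ_le_const2) (use elim in auto)
  qed
  then show "square_integrable M g"
    by (intro square_integrable_bound[OF h g]) (auto elim!: eventually_mono)
  have "(\<lambda>k. \<integral>x. (f k x - g x)\<^sup>2 \<partial>M) \<longlonglongrightarrow> (\<integral>x. 0 \<partial>M)"
  proof (rule integral_dominated_convergence)
    \<comment> \<open>Both \<open>f k\<close> and its limit are bounded by \<open>h\<close>, so
      their difference is at most \<open>2 * h\<close>.\<close>
    show "integrable M (\<lambda>x. 4 * (h x)\<^sup>2)"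
      using square_integrable_real_power2[OF h] by simp
    show "AE x in M. (\<lambda>k. (f k x - g x)\<^sup>2) \<longlonglongrightarrow> 0"
      using lim by eventually_elim (auto intro!: tendsto_eq_intros)
    show "AE x in M. norm ((f k x - g x)\<^sup>2) \<le> 4 * (h x)\<^sup>2" for k
      using gh bound[of k]
    proof eventually_elim
      case (elim x)
      then have "\<bar>f k x - g x\<bar> \<le> 2 * h x" by linarith
      then have "(f k x - g x)\<^sup>2 \<le> (2 * h x)\<^sup>2"
        using abs_le_square_iff[of "f k x - g x" "2 * h x"] elim by simp
      then show ?case by (simp add: power_mult_distrib)
    qed
  qed measurable
  then show "(\<lambda>k. \<integral>x. (f k x - g x)\<^sup>2 \<partial>M) \<longlonglongrightarrow> 0" by simp
qed

text \<open>Square integrability is included because a nonintegrable square has Bochner integral 0,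
  which would make the second condition hold trivially.\<close>

definition approximable :: "(real ^ 'n \<Rightarrow> real) \<Rightarrow> bool" where
  "approximable g \<longleftrightarrow> square_integrable gauss g \<and>
    (\<forall>\<epsilon>>0. \<exists>\<psi>. smooth_cpt \<psi> \<and> (\<integral>x. (\<psi> x - g x)\<^sup>2 \<partial>gauss) < \<epsilon>)"

lemma approximable_smooth_cpt: "smooth_cpt \<psi> \<Longrightarrow> approximable \<psi>"
  unfolding approximable_def by (auto intro!: square_integrable_smooth_cpt exI[of _ \<psi>])

lemma approximable_limit:
  assumes f: "\<And>k. approximable (f k)" and g: "square_integrable gauss g"
    and lim: "(\<lambda>k. \<integral>x. (f k x - g x)\<^sup>2 \<partial>gauss) \<longlonglongrightarrow> 0"
  shows "approximable g"
  unfolding approximable_def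
proof (intro conjI allI impI g)
  fix \<epsilon> :: real assume "0 < \<epsilon>"
  \<comment> \<open>A quarter for each error, since the square of a sum costs a factor 2 on both
    terms.\<close>
  then have "\<forall>\<^sub>F k in sequentially. (\<integral>x. (f k x - g x)\<^sup>2 \<partial>gauss) < \<epsilon> / 4"
    by (intro order_tendstoD(2)[OF lim]) simp
  then obtain k where k: "(\<integral>x. (f k x - g x)\<^sup>2 \<partial>gauss) < \<epsilon> / 4"
    by (auto simp: eventually_sequentially)
  obtain \<psi> where \<psi>: "smooth_cpt \<psi>" "(\<integral>x. (\<psi> x - f k x)\<^sup>2 \<partial>gauss) < \<epsilon> / 4"
    using f[of k] \<open>0 < \<epsilon>\<close> unfolding approximable_def by (metis zero_less_divide_iff zero_less_numeral)
  have "square_integrable gauss (f k)" using f by (simp add: approximable_def)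
  with square_integrable_smooth_cpt(1)[OF \<psi>(1)] have "(\<integral>x. (norm ((\<psi> x - f k x) + (f k x - g x)))\<^sup>2 \<partial>gauss) \<le>
      2 * (\<integral>x. (norm (\<psi> x - f k x))\<^sup>2 \<partial>gauss) + 2 * (\<integral>x. (norm (f k x - g x))\<^sup>2 \<partial>gauss)"
    using g by (intro integral_norm_add_power2_le square_integrable_diff)
  then show "\<exists>\<psi>. smooth_cpt \<psi> \<and> (\<integral>x. (\<psi> x - g x)\<^sup>2 \<partial>gauss) < \<epsilon>"
    using k \<psi> by (intro exI[of _ \<psi>]) simp
qed

lemma approximable_dominated_limit:
  assumes f: "\<And>k. approximable (f k)" and "g \<in> borel_measurable gauss" and h: "square_integrable gauss h"
    and "AE x in gauss. (\<lambda>k. f k x) \<longlonglongrightarrow> g x" and "\<And>k. AE x in gauss. \<bar>f k x\<bar> \<le> h x"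
  shows "approximable g"
proof -
  have "f k \<in> borel_measurable gauss" for k
    using f[of k] by (simp add: approximable_def square_integrable_def)
  from square_integrable_dominated_convergence[OF this assms(2-5)]
  show ?thesis by (intro approximable_limit[OF f])
qed

lemma approximable_lincomb:
  assumes f: "approximable f" and g: "approximable g"
  shows "approximable (\<lambda>x. a * f x + b * g x)"
  unfolding approximable_def
proof (intro conjI allI impI)
  have s: "square_integrable gauss f" "square_integrable gauss g"
    using f g by (auto simp: approximable_def)
  then show "square_integrable gauss (\<lambda>x. a * f x + b * g x)"
    by (intro square_integrable_add square_integrable_cmult)
  fix \<epsilon> :: real assume "0 < \<epsilon>"
  \<comment> \<open>This absorbs the factors \<open>2 * a\<^sup>2\<close> and
    \<open>2 * b\<^sup>2\<close>; the summand 1 keeps the denominator positive and the final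
    inequality strict.\<close>
  define \<delta> where "\<delta> = \<epsilon> / (2 * (a\<^sup>2 + b\<^sup>2 + 1))"
  have "0 < a\<^sup>2 + b\<^sup>2 + 1" by (simp add: add_nonneg_pos)
  then have \<delta>: "0 < \<delta>" "2 * (a\<^sup>2 + b\<^sup>2 + 1) * \<delta> = \<epsilon>" using \<open>0 < \<epsilon>\<close> by (auto simp: \<delta>_def)
  obtain \<phi> where \<phi>: "smooth_cpt \<phi>" "(\<integral>x. (\<phi> x - f x)\<^sup>2 \<partial>gauss) < \<delta>"
    using f \<delta> unfolding approximable_def by blast
  obtain \<psi> where \<psi>: "smooth_cpt \<psi>" "(\<integral>x. (\<psi> x - g x)\<^sup>2 \<partial>gauss) < \<delta>"
    using g \<delta> unfolding approximable_def by blast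
  have "(\<integral>x. (norm (a * (\<phi> x - f x) + b * (\<psi> x - g x)))\<^sup>2 \<partial>gauss) \<le>
      2 * (\<integral>x. (norm (a * (\<phi> x - f x)))\<^sup>2 \<partial>gauss) + 2 * (\<integral>x. (norm (b * (\<psi> x - g x)))\<^sup>2 \<partial>gauss)"
    using s square_integrable_smooth_cpt(1)[OF \<phi>(1)] square_integrable_smooth_cpt(1)[OF \<psi>(1)]
    by (intro integral_norm_add_power2_le square_integrable_cmult square_integrable_diff)
  then have "(\<integral>x. (a * (\<phi> x - f x) + b * (\<psi> x - g x))\<^sup>2 \<partial>gauss) \<le>
      2 * (a\<^sup>2 * (\<integral>x. (\<phi> x - f x)\<^sup>2 \<partial>gauss)) + 2 * (b\<^sup>2 * (\<integral>x. (\<psi> x - g x)\<^sup>2 \<partial>gauss))"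
    by (simp add: power_mult_distrib)
  also have "\<dots> \<le> 2 * (a\<^sup>2 * \<delta>) + 2 * (b\<^sup>2 * \<delta>)"
    using \<phi> \<psi> by (intro add_mono mult_left_mono) auto
  also have "\<dots> < 2 * (a\<^sup>2 + b\<^sup>2 + 1) * \<delta>"
    using \<delta> by (simp add: algebra_simps)
  finally have "(\<integral>x. (a * (\<phi> x - f x) + b * (\<psi> x - g x))\<^sup>2 \<partial>gauss) < \<epsilon>" using \<delta> by simp
  moreover have "a * (\<phi> x - f x) + b * (\<psi> x - g x) = (a * \<phi> x + b * \<psi> x) - (a * f x + b * g x)" for x
    by (simp add: algebra_simps)
  ultimately show "\<exists>\<psi>. smooth_cpt \<psi> \<and> (\<integral>x. (\<psi> x - (a * f x + b * g x))\<^sup>2 \<partial>gauss) < \<epsilon>"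
    using smooth_cpt_lincomb[OF \<phi>(1) \<psi>(1), of a b] by (intro exI[of _ "\<lambda>x. a * \<phi> x + b * \<psi> x"]) simp
qed

lemma square_integrable_gauss_const: "square_integrable gauss (\<lambda>x. c :: real)"
  by (rule square_integrable_gauss_bounded) auto

text \<open>For positive \<open>s\<close> the values \<open>exp (- 1 / ((k + 1) s))\<close> tend to
  1; for all other \<open>s\<close> they are 0. The open half-line is what fits open boxes.\<close>

lemma bump_0_limit: "(\<lambda>k. bump 0 (real (Suc k) * s)) \<longlonglongrightarrow> indicator {0<..} s"
proof (cases "0 < s")
  case True
  have "(\<lambda>k. exp (- ((1 / s) * inverse (real (Suc k))))) \<longlonglongrightarrow> exp (- ((1 / s) * 0))"
    by (intro tendsto_intros LIMSEQ_inverse_real_of_nat)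
  then show ?thesis
    using True by (simp add: bump_def divide_inverse mult.commute)
next
  case False
  then have "\<not> 0 < real (Suc k) * s" for k by (simp add: zero_less_mult_iff)
  then show ?thesis using False by (simp add: bump_def)
qed

lemma bump_0_le_1: "bump 0 t \<le> 1"
  by (simp add: bump_def)

text \<open>A product of rescaled bumps, one for each face, is positive exactly on the open box and
  converges to its indicator, dominated by 1.\<close>

lemma approximable_indicator_box: "approximable (indicator (box a b) :: real ^ 'n \<Rightarrow> real)"
proof (rule approximable_dominated_limit[where h = "\<lambda>_. 1"])
  define \<psi> where "\<psi> k x = (\<Prod>i\<in>UNIV. bump 0 (real (Suc k) * (x $ i - a $ i)) * bump 0 (real (Suc k) * (b $ i - x $ i)))"
    for k and x :: "real ^ 'n"
  show "approximable (\<psi> k)" for k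
  proof (rule approximable_smooth_cpt, rule smooth_cptI)
    have "bump_algebra (\<lambda>x :: real ^ 'n. bump 0 (real (Suc k) * (x $ i - a $ i)) * bump 0 (real (Suc k) * (b $ i - x $ i)))" for i
      using bump_algebra.mult[OF bump_algebra.coord[of 0 "real (Suc k)" i "- real (Suc k) * a $ i"]
          bump_algebra.coord[of 0 "- real (Suc k)" i "real (Suc k) * b $ i"]]
      by (simp add: algebra_simps)
    then show "smooth_fun (\<psi> k)"
      unfolding \<psi>_def by (intro smooth_fun_bump_algebra bump_algebra_prod) auto
    fix x assume "\<psi> k x \<noteq> 0"
    then have *: "\<And>i. bump 0 (real (Suc k) * (x $ i - a $ i)) \<noteq> 0 \<and> bump 0 (real (Suc k) * (b $ i - x $ i)) \<noteq> 0"
      unfolding \<psi>_def by (simp del: of_nat_Suc)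
    have "a $ i < x $ i \<and> x $ i < b $ i" for i
      using *[of i] by (simp add: bump_def zero_less_mult_iff split: if_splits)
    then have "x \<in> box a b" by (simp add: mem_box_cart)
    \<comment> \<open>Any radius bounding the box serves; boundedness of the box guarantees that the
      choice is meaningful.\<close>
    then show "norm x \<le> (SOME R. \<forall>x\<in>box a b. norm x \<le> R)"
      using someI_ex[OF bounded_box[unfolded bounded_iff, of a b]] by blast
  qed
  have "(\<lambda>k. \<psi> k x) \<longlonglongrightarrow> indicator (box a b) x" for x
  proof -
    have "indicator (box a b) x = (\<Prod>i\<in>UNIV. indicator {0<..} (x $ i - a $ i) * indicator {0<..} (b $ i - x $ i) :: real)"
    proof (cases "x \<in> box a b")
      case True
      then show ?thesis by (simp add: mem_box_cart)
    next
      case False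
      then obtain i where "\<not> (a $ i < x $ i \<and> x $ i < b $ i)" by (auto simp: mem_box_cart)
      then have "\<exists>i. indicator {0<..} (x $ i - a $ i) * indicator {0<..} (b $ i - x $ i) = (0 :: real)"
        by (intro exI[of _ i]) (auto simp: indicator_def)
      then show ?thesis using False by (simp add: prod_zero)
    qed
    then show ?thesis
      unfolding \<psi>_def by (simp only:) (intro tendsto_prod tendsto_mult bump_0_limit)
  qed
  then show "AE x in gauss. (\<lambda>k. \<psi> k x) \<longlonglongrightarrow> indicator (box a b) x" by simp
  have "\<bar>\<psi> k x\<bar> \<le> 1" for k x
    unfolding \<psi>_def abs_prod
    by (intro prod_le_1 conjI) (auto simp: abs_mult bump_nonneg bump_0_le_1 intro!: mult_le_one)
  then show "AE x in gauss. \<bar>\<psi> k x\<bar> \<le> 1" for k by simp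
qed (auto intro: square_integrable_gauss_const)

text \<open>The constant has no compact support, so it is reached by exhausting the space with
  boxes. Complements of Borel sets depend on it.\<close>

lemma approximable_1: "approximable (\<lambda>x :: real ^ 'n. 1)"
proof (rule approximable_dominated_limit[where h = "\<lambda>_. 1"])
  show "approximable (indicator (box (- (\<chi> i. real k)) (\<chi> i. real k)) :: real ^ 'n \<Rightarrow> real)" for k
    by (rule approximable_indicator_box)
  have "\<forall>\<^sub>F k in sequentially. indicator (box (- (\<chi> i. real k)) (\<chi> i. real k)) x = (1 :: real)" for x :: "real ^ 'n"
  proof (rule eventually_sequentiallyI[of "Suc (nat \<lceil>norm x\<rceil>)"])
    fix k assume "Suc (nat \<lceil>norm x\<rceil>) \<le> k"
    then have "norm x < real k" by linarith
    then have "\<bar>x $ i\<bar> < real k" for i using component_le_norm_cart[of x i] by linarith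
    then show "indicator (box (- (\<chi> i. real k)) (\<chi> i. real k)) x = (1 :: real)"
      by (simp add: mem_box_cart indicator_def abs_less_iff) (metis minus_less_iff)
  qed
  then show "AE x in gauss. (\<lambda>k. indicator (box (- (\<chi> i. real k)) (\<chi> i. real k)) (x :: real ^ 'n) :: real) \<longlonglongrightarrow> 1"
    by (intro AE_I2 tendsto_eventually)
qed (auto intro: square_integrable_gauss_const simp: indicator_def)

text \<open>Dynkin's argument: open boxes are stable under intersection and generate the Borel sets;
  complements follow by linearity, disjoint unions by dominated convergence with bound 1.\<close>

lemma approximable_indicator:
  assumes "A \<in> sets borel"
  shows "approximable (indicator A :: real ^ 'n \<Rightarrow> real)"
proof -
  define G where "G = range (\<lambda>(a, b). box a b :: (real ^ 'n) set)"
  have borel: "sets borel = sigma_sets UNIV G"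
    unfolding G_def by (subst borel_eq_box) simp
  have "Int_stable G" unfolding G_def Int_stable_def by (auto simp: box_Int_box)
  moreover have "G \<subseteq> Pow UNIV" by simp
  moreover have "A \<in> sigma_sets UNIV G" using assms borel by simp
  ultimately show ?thesis
  proof (induction rule: sigma_sets_induct_disjoint)
    case (basic A)
    then show ?case by (auto simp: G_def approximable_indicator_box)
  next
    case empty
    have "approximable (\<lambda>x :: real ^ 'n. 0 * 1 + 0 * 1)" by (intro approximable_lincomb approximable_1)
    then show ?case by (simp add: indicator_def[abs_def])
  next
    case (compl A)
    have "approximable (\<lambda>x. 1 * 1 + (- 1) * indicator A x)"
      by (intro approximable_lincomb approximable_1 compl)
    moreover have "(\<lambda>x. 1 * 1 + (- 1) * indicator A x) = (indicator (UNIV - A) :: real ^ 'n \<Rightarrow> real)"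
      by (auto simp: indicator_def)
    ultimately show ?case by simp
  next
    case (union A)
    define S where "S k x = (\<Sum>i<k. indicator (A i) x :: real)" for k x
    have S: "S k = indicator (\<Union>i<k. A i)" for k
    proof -
      have "disjoint_family_on A {..<k}" using union(1) by (auto simp: disjoint_family_on_def)
      then show ?thesis unfolding S_def by (auto simp: indicator_UN_disjoint fun_eq_iff)
    qed
    show ?case
    proof (rule approximable_dominated_limit[where h = "\<lambda>_. 1"])
      show "approximable (S k)" for k
      proof (induction k)
        case 0
        have "approximable (\<lambda>x :: real ^ 'n. 0 * 1 + 0 * 1)" by (intro approximable_lincomb approximable_1)
        then show ?case by (simp add: S_def[abs_def])
      next
        case (Suc k)
        have "approximable (\<lambda>x. 1 * S k x + 1 * indicator (A k) x)"
          by (intro approximable_lincomb Suc union)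
        then show ?case by (simp add: S_def[abs_def])
      qed
      have "range A \<subseteq> sets borel" using union(2) borel by simp
      then have "(\<Union>i. A i) \<in> sets borel" by (rule sets.countable_UN)
      then show "indicator (\<Union>i. A i) \<in> borel_measurable gauss" by simp
      show "AE x in gauss. (\<lambda>k. S k x) \<longlonglongrightarrow> indicator (\<Union>i. A i) x"
        unfolding S by (intro AE_I2 LIMSEQ_indicator_UN)
      show "AE x in gauss. \<bar>S k x\<bar> \<le> 1" for k
        unfolding S by (auto simp: indicator_def)
    qed (rule square_integrable_gauss_const)
  qed
qed

text \<open>Square integrability is a premise inside the induction formula, because the pieces of
  \<open>g\<close> inherit it only from \<open>g\<close>, through domination or scaling.\<close>

lemma approximable_nonneg:
  assumes "g \<in> borel_measurable gauss" "\<And>x. 0 \<le> g x"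
  shows "square_integrable gauss g \<longrightarrow> approximable g"
  using assms
proof (induction rule: borel_measurable_induct_real)
  case (set A)
  then show ?case by (simp add: approximable_indicator)
next
  case (mult u c)
  show ?case
  \<comment> \<open>Passing from \<open>c * u\<close> back to \<open>u\<close> divides by
    \<open>c\<close>.\<close>
  proof (cases "c = 0")
    case True
    have "approximable (\<lambda>x :: real ^ 'a. 0 * 1 + 0 * 1)" by (intro approximable_lincomb approximable_1)
    then show ?thesis using True by simp
  next
    case False
    show ?thesis
    proof
      assume "square_integrable gauss (\<lambda>x. c * u x)"
      from square_integrable_cmult[OF this, of "inverse c"] False
      have "approximable u" using mult by (simp add: mult.assoc[symmetric])
      from approximable_lincomb[OF this this, of c 0]
      show "approximable (\<lambda>x. c * u x)" by simp
    qed
  qed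
next
  case (add u v)
  show ?case
  proof
    assume s: "square_integrable gauss (\<lambda>x. v x + u x)"
    have "square_integrable gauss u" "square_integrable gauss v"
      using add by (auto intro!: square_integrable_bound[OF s] AE_I2)
    then show "approximable (\<lambda>x. v x + u x)"
      using add approximable_lincomb[of v u 1 1] by simp
  qed
next
  case (seq U)
  show ?case
  proof
    assume s: "square_integrable gauss g"
    have le: "U i x \<le> g x" for i x
      by (rule incseq_le[of "\<lambda>i. U i x"]) (use seq in \<open>auto simp: incseq_def le_fun_def\<close>)
    have nn: "0 \<le> U i x" for i x by (rule seq(2))
    have "norm (U i x) \<le> norm (g x)" for i x
      using nn[of i x] le[of i x] by simp
    then have U: "square_integrable gauss (U i)" for i
      by (intro square_integrable_bound[OF s seq(1)] AE_I2)
    show "approximable g"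
    proof (rule approximable_dominated_limit[where f = U and h = g])
      show "approximable (U k)" for k using seq U by blast
      show "AE x in gauss. \<bar>U k x\<bar> \<le> g x" for k
        by (rule AE_I2) (simp add: nn le)
      show "AE x in gauss. (\<lambda>k. U k x) \<longlonglongrightarrow> g x"
        by (rule AE_I2) (use seq in simp)
    qed (fact assms(1) s)+
  qed
qed

lemma approximable_square_integrable:
  assumes g: "square_integrable gauss g"
  shows "approximable g"
proof -
  note [measurable] = square_integrable_measurable[OF g]
  have "approximable (\<lambda>x. max (g x) 0)" "approximable (\<lambda>x. max (- g x) 0)"
    by (rule approximable_nonneg[rule_format]; (auto intro!: square_integrable_bound[OF g])?)+
  from approximable_lincomb[OF this, of 1 "- 1"]
  have "approximable (\<lambda>x. max (g x) 0 - max (- g x) 0)" by simp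
  moreover have "(\<lambda>x. max (g x) 0 - max (- g x) 0) = g" by (auto simp: max_def)
  ultimately show ?thesis by simp
qed

section \<open>The minimizer\<close>

lemma H1_gaussE:
  assumes "H1_gauss u G"
  obtains \<phi> where "square_integrable gauss u" "square_integrable gauss G" "\<forall>k. smooth_cpt (\<phi> k)"
    "(\<lambda>k. \<integral>x. (norm (\<phi> k x - u x))\<^sup>2 \<partial>gauss) \<longlonglongrightarrow> 0"
    "(\<lambda>k. \<integral>x. (norm (grad (\<phi> k) x - G x))\<^sup>2 \<partial>gauss) \<longlonglongrightarrow> 0"
  using assms unfolding H1_gauss_def square_integrable_def by auto

lemma H1_gauss_square_integrable:
  assumes "H1_gauss u G"
  shows "square_integrable gauss u" "square_integrable gauss G"
  using assms by (simp_all add: H1_gauss_def square_integrable_def)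

lemma integral_norm_diff_power2_lt:
  fixes f g h :: "'a \<Rightarrow> 'b :: euclidean_space"
  assumes "square_integrable M f" "square_integrable M g" "square_integrable M h"
    and "(\<integral>x. (norm (f x - g x))\<^sup>2 \<partial>M) < \<epsilon> / 4" "(\<integral>x. (norm (g x - h x))\<^sup>2 \<partial>M) < \<epsilon> / 4"
  shows "(\<integral>x. (norm (f x - h x))\<^sup>2 \<partial>M) < \<epsilon>"
  using integral_norm_add_power2_le[OF square_integrable_diff[OF assms(1,2)] square_integrable_diff[OF assms(2,3)]]
    assms(4,5) by simp

text \<open>A limit of limits: for each accuracy, first a member of the sequence and then a test
  function near it in both components; choosing one test function for each accuracy
  \<open>1 / (n + 1)\<close> gives the new sequence.\<close>

lemma H1_gauss_limit:
  fixes u :: "real ^ 'n \<Rightarrow> real"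
  assumes H1: "\<And>k. H1_gauss (U k) (F k)" and u: "square_integrable gauss u" and G: "square_integrable gauss G"
    and limu: "(\<lambda>k. \<integral>x. (norm (U k x - u x))\<^sup>2 \<partial>gauss) \<longlonglongrightarrow> 0"
    and limG: "(\<lambda>k. \<integral>x. (norm (F k x - G x))\<^sup>2 \<partial>gauss) \<longlonglongrightarrow> 0"
  shows "H1_gauss u G"
proof -
  have "\<exists>\<psi>. smooth_cpt \<psi> \<and> (\<integral>x. (norm (\<psi> x - u x))\<^sup>2 \<partial>gauss) < \<epsilon> \<and>
      (\<integral>x. (norm (grad \<psi> x - G x))\<^sup>2 \<partial>gauss) < \<epsilon>" if "0 < \<epsilon>" for \<epsilon> :: real
  proof -
    have \<epsilon>: "0 < \<epsilon> / 4" using that by simp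
    obtain k where k: "(\<integral>x. (norm (U k x - u x))\<^sup>2 \<partial>gauss) < \<epsilon> / 4" "(\<integral>x. (norm (F k x - G x))\<^sup>2 \<partial>gauss) < \<epsilon> / 4"
      using eventually_conj[OF order_tendstoD(2)[OF limu \<epsilon>] order_tendstoD(2)[OF limG \<epsilon>]]
      by (auto simp: eventually_sequentially)
    obtain \<phi> where s: "square_integrable gauss (U k)" "square_integrable gauss (F k)" and \<phi>': "\<forall>j. smooth_cpt (\<phi> j)"
      and lim: "(\<lambda>j. \<integral>x. (norm (\<phi> j x - U k x))\<^sup>2 \<partial>gauss) \<longlonglongrightarrow> 0"
        "(\<lambda>j. \<integral>x. (norm (grad (\<phi> j) x - F k x))\<^sup>2 \<partial>gauss) \<longlonglongrightarrow> 0"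
      by (rule H1_gaussE[OF H1[of k]])
    note \<phi> = \<phi>'[rule_format]
    obtain j where j: "(\<integral>x. (norm (\<phi> j x - U k x))\<^sup>2 \<partial>gauss) < \<epsilon> / 4"
        "(\<integral>x. (norm (grad (\<phi> j) x - F k x))\<^sup>2 \<partial>gauss) < \<epsilon> / 4"
      using eventually_conj[OF order_tendstoD(2)[OF lim(1) \<epsilon>] order_tendstoD(2)[OF lim(2) \<epsilon>]]
      by (auto simp: eventually_sequentially)
    show ?thesis
      using \<phi>[of j] integral_norm_diff_power2_lt[OF square_integrable_smooth_cpt(1)[OF \<phi>] s(1) u j(1) k(1)]
        integral_norm_diff_power2_lt[OF square_integrable_smooth_cpt(2)[OF \<phi>] s(2) G j(2) k(2)] by blast
  qed
  then have "\<forall>n. \<exists>\<psi>. smooth_cpt \<psi> \<and> (\<integral>x. (norm (\<psi> x - u x))\<^sup>2 \<partial>gauss) < inverse (real (Suc n)) \<and>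
      (\<integral>x. (norm (grad \<psi> x - G x))\<^sup>2 \<partial>gauss) < inverse (real (Suc n))"
    by simp
  from choice[OF this] obtain \<psi> where "\<forall>n. smooth_cpt (\<psi> n) \<and>
      (\<integral>x. (norm (\<psi> n x - u x))\<^sup>2 \<partial>gauss) < inverse (real (Suc n)) \<and>
      (\<integral>x. (norm (grad (\<psi> n) x - G x))\<^sup>2 \<partial>gauss) < inverse (real (Suc n))" ..
  then have \<psi>: "smooth_cpt (\<psi> n)"
    "(\<integral>x. (norm (\<psi> n x - u x))\<^sup>2 \<partial>gauss) < inverse (real (Suc n))"
    "(\<integral>x. (norm (grad (\<psi> n) x - G x))\<^sup>2 \<partial>gauss) < inverse (real (Suc n))" for n
    by simp_all
  have "(\<lambda>n. \<integral>x. (norm (\<psi> n x - u x))\<^sup>2 \<partial>gauss) \<longlonglongrightarrow> 0"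
    by (rule tendsto_sandwich[OF _ _ tendsto_const LIMSEQ_inverse_real_of_nat])
      (auto intro!: always_eventually less_imp_le \<psi>(2)[simplified])
  moreover have "(\<lambda>n. \<integral>x. (norm (grad (\<psi> n) x - G x))\<^sup>2 \<partial>gauss) \<longlonglongrightarrow> 0"
    by (rule tendsto_sandwich[OF _ _ tendsto_const LIMSEQ_inverse_real_of_nat])
      (auto intro!: always_eventually less_imp_le \<psi>(3)[simplified])
  ultimately show ?thesis
    unfolding H1_gauss_def using u G \<psi>(1) by (auto simp: square_integrable_def)
qed

text \<open>Averaging is linear up to null sets and bounded on \<open>L\<^sup>2\<close>, hence
  continuous.\<close>

lemma avg_tendsto:
  assumes W: "square_integrable noise W" and f: "\<And>k. square_integrable gauss (f k)" and g: "square_integrable gauss g"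
    and lim: "(\<lambda>k. \<integral>x. (f k x - g x)\<^sup>2 \<partial>gauss) \<longlonglongrightarrow> 0"
  shows "(\<lambda>k. \<integral>x. (norm (avg W (f k) x - avg W g x))\<^sup>2 \<partial>gauss) \<longlonglongrightarrow> 0"
proof (rule tendsto_sandwich[OF _ _ tendsto_const])
  define K where "K = (\<integral>q. (norm (W q))\<^sup>2 \<partial>noise) * (pi / 2)"
  show "(\<lambda>k. K * (\<integral>x. (f k x - g x)\<^sup>2 \<partial>gauss)) \<longlonglongrightarrow> 0"
    using tendsto_mult[OF tendsto_const lim, of K] by simp
  have "(\<integral>x. (norm (avg W (f k) x - avg W g x))\<^sup>2 \<partial>gauss) \<le> K * (\<integral>x. (f k x - g x)\<^sup>2 \<partial>gauss)" for k
  proof -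
    note s = square_integrable_diff[OF f[of k] g]
    note m = square_integrable_avg(1)[OF W f[of k]] square_integrable_avg(1)[OF W g] square_integrable_avg(1)[OF W s]
    note [measurable] = m[THEN square_integrable_measurable]
    have "(\<integral>x. (norm (avg W (f k) x - avg W g x))\<^sup>2 \<partial>gauss) = (\<integral>x. (norm (avg W (\<lambda>x. f k x - g x) x))\<^sup>2 \<partial>gauss)"
      using avg_diff[OF W f[of k] g] by (intro integral_cong_AE) (auto elim!: eventually_mono)
    then show ?thesis
      using square_integrable_avg(2)[OF W s] by (simp add: K_def)
  qed
  then show "\<forall>\<^sub>F k in sequentially. (\<integral>x. (norm (avg W (f k) x - avg W g x))\<^sup>2 \<partial>gauss) \<le> K * (\<integral>x. (f k x - g x)\<^sup>2 \<partial>gauss)"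
    by simp
qed simp

text \<open>Approximate \<open>g\<close> by test functions, where membership is known; both averages
  then converge in \<open>L\<^sup>2\<close>, and the Sobolev graph is closed.\<close>

lemma H1_gauss_res:
  assumes g: "square_integrable gauss g"
  shows "H1_gauss (res g) (res_grad g)"
proof -
  have "\<exists>\<psi>. smooth_cpt \<psi> \<and> (\<integral>x. (\<psi> x - g x)\<^sup>2 \<partial>gauss) < inverse (real (Suc n))" for n
    using approximable_square_integrable[OF g] by (simp add: approximable_def)
  then obtain \<psi> where \<psi>: "\<And>n. smooth_cpt (\<psi> n)" "\<And>n. (\<integral>x. (\<psi> n x - g x)\<^sup>2 \<partial>gauss) < inverse (real (Suc n))"
    by metis
  have lim: "(\<lambda>n. \<integral>x. (\<psi> n x - g x)\<^sup>2 \<partial>gauss) \<longlonglongrightarrow> 0"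
    by (rule tendsto_sandwich[OF _ _ tendsto_const LIMSEQ_inverse_real_of_nat])
      (auto intro!: always_eventually less_imp_le \<psi>(2)[simplified])
  show ?thesis
  proof (rule H1_gauss_limit)
    show "H1_gauss (res (\<psi> n)) (res_grad (\<psi> n))" for n by (rule H1_gauss_res_smooth[OF \<psi>(1)])
    show "(\<lambda>n. \<integral>x. (norm (res (\<psi> n) x - res g x))\<^sup>2 \<partial>gauss) \<longlonglongrightarrow> 0"
      unfolding res_def
      by (rule avg_tendsto[OF square_integrable_res_weight square_integrable_smooth_cpt(1)[OF \<psi>(1)] g lim])
    show "(\<lambda>n. \<integral>x. (norm (res_grad (\<psi> n) x - res_grad g x))\<^sup>2 \<partial>gauss) \<longlonglongrightarrow> 0"
      unfolding res_grad_def
      by (rule avg_tendsto[OF square_integrable_res_grad_weight square_integrable_smooth_cpt(1)[OF \<psi>(1)] g lim])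
  qed (rule square_integrable_res square_integrable_res_grad g)+
qed

text \<open>Every term is \<open>L\<^sup>2\<close>-continuous in \<open>v\<close> or
  \<open>H\<close>, so the equation passes to the limit along the test functions that define
  membership.\<close>

lemma res_weak_equation_H1:
  assumes g: "square_integrable gauss g" and H1: "H1_gauss v H"
  shows "(\<integral>x. res_grad g x \<bullet> H x \<partial>gauss) + (\<integral>x. res g x * v x \<partial>gauss) = (\<integral>x. g x * v x \<partial>gauss)"
proof -
  obtain \<phi> where v: "square_integrable gauss v" and H: "square_integrable gauss H" and \<phi>': "\<forall>k. smooth_cpt (\<phi> k)"
    and lim: "(\<lambda>k. \<integral>x. (norm (\<phi> k x - v x))\<^sup>2 \<partial>gauss) \<longlonglongrightarrow> 0"
      "(\<lambda>k. \<integral>x. (norm (grad (\<phi> k) x - H x))\<^sup>2 \<partial>gauss) \<longlonglongrightarrow> 0"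
    by (rule H1_gaussE[OF H1])
  note \<phi> = \<phi>'[rule_format]
  have weak: "(\<integral>x. res_grad g x \<bullet> grad (\<phi> k) x \<partial>gauss) + (\<integral>x. res g x * \<phi> k x \<partial>gauss) = (\<integral>x. g x * \<phi> k x \<partial>gauss)" for k
  proof -
    obtain B where B: "\<And>x. \<bar>\<phi> k x\<bar> \<le> B" using smooth_cpt_bounded[OF \<phi>] by blast
    obtain C where C: "\<And>x. norm (grad (\<phi> k) x) \<le> C" using smooth_cpt_grad_bounded[OF \<phi>] by blast
    note s = smooth_cpt_smooth_fun[OF \<phi>]
    show ?thesis
      by (rule res_weak_equation[OF g has_derivative_grad[OF smooth_fun_differentiable[OF s]] continuous_on_grad[OF s] B C])
  qed
  note s = square_integrable_smooth_cpt[OF \<phi>]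
  have "(\<lambda>k. (\<integral>x. res_grad g x \<bullet> grad (\<phi> k) x \<partial>gauss) + (\<integral>x. res g x \<bullet> \<phi> k x \<partial>gauss)) \<longlonglongrightarrow>
      (\<integral>x. res_grad g x \<bullet> H x \<partial>gauss) + (\<integral>x. res g x \<bullet> v x \<partial>gauss)"
    by (intro tendsto_add tendsto_integral_inner_L2 s v H square_integrable_res square_integrable_res_grad g lim)
  moreover have "(\<lambda>k. \<integral>x. g x \<bullet> \<phi> k x \<partial>gauss) \<longlonglongrightarrow> (\<integral>x. g x \<bullet> v x \<partial>gauss)"
    by (intro tendsto_integral_inner_L2 s v g lim)
  ultimately show ?thesis
    using weak LIMSEQ_unique by (simp add: inner_real_def)
qed

text \<open>Expanding the squares leaves cross terms, which cancel by the weak equation tested with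
  \<open>v\<close> and with \<open>res g\<close> itself.\<close>

lemma energy_eq:
  fixes g :: "real ^ 'n \<Rightarrow> real"
  assumes g: "square_integrable gauss g" and H1: "H1_gauss v H"
  shows "energy g v H = energy g (res g) (res_grad g)
    + (\<integral>x. (norm (H x - res_grad g x))\<^sup>2 \<partial>gauss) / 2 + (\<integral>x. (v x - res g x)\<^sup>2 \<partial>gauss) / 2"
proof -
  define u G where "u = res g" and "G = res_grad g"
  have u: "square_integrable gauss u" and G: "square_integrable gauss G"
    unfolding u_def G_def by (rule square_integrable_res square_integrable_res_grad g)+
  have v: "square_integrable gauss v" and H: "square_integrable gauss H"
    using H1 by (rule H1_gauss_square_integrable)+
  note n = square_integrable_norm_power2 and r = square_integrable_real_power2
  note i = square_integrable_inner square_integrable_mult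
  have w1: "(\<integral>x. G x \<bullet> H x \<partial>gauss) + (\<integral>x. u x * v x \<partial>gauss) = (\<integral>x. g x * v x \<partial>gauss)"
    unfolding u_def G_def by (rule res_weak_equation_H1[OF g H1])
  have w2: "(\<integral>x. G x \<bullet> G x \<partial>gauss) + (\<integral>x. u x * u x \<partial>gauss) = (\<integral>x. g x * u x \<partial>gauss)"
    unfolding u_def G_def by (rule res_weak_equation_H1[OF g H1_gauss_res[OF g]])
  have e1: "(\<integral>x. (norm (H x))\<^sup>2 / 2 \<partial>gauss) = (\<integral>x. (norm (H x))\<^sup>2 \<partial>gauss) / 2"
    and e2: "(\<integral>x. (norm (G x))\<^sup>2 / 2 \<partial>gauss) = (\<integral>x. G x \<bullet> G x \<partial>gauss) / 2"
    by (simp_all add: power2_norm_eq_inner)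
  have sq: "(\<integral>x. (a x - b x)\<^sup>2 \<partial>gauss) = (\<integral>x. (a x)\<^sup>2 \<partial>gauss) - 2 * (\<integral>x. b x * a x \<partial>gauss) + (\<integral>x. b x * b x \<partial>gauss)"
    if "square_integrable gauss a" "square_integrable gauss b" for a b :: "real ^ 'n \<Rightarrow> real"
  proof -
    have "(\<integral>x. (a x - b x)\<^sup>2 \<partial>gauss) = (\<integral>x. (a x)\<^sup>2 - 2 * (b x * a x) + b x * b x \<partial>gauss)"
      by (intro Bochner_Integration.integral_cong refl) (simp add: power2_eq_square algebra_simps)
    then show ?thesis
      using that by (simp add: i r)
  qed
  have "(\<integral>x. (norm (H x - G x))\<^sup>2 \<partial>gauss) = (\<integral>x. (norm (H x))\<^sup>2 - 2 * (G x \<bullet> H x) + G x \<bullet> G x \<partial>gauss)"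
    by (intro Bochner_Integration.integral_cong refl) (simp add: power2_norm_eq_inner inner_diff inner_commute)
  also have "\<dots> = (\<integral>x. (norm (H x))\<^sup>2 \<partial>gauss) - 2 * (\<integral>x. G x \<bullet> H x \<partial>gauss) + (\<integral>x. G x \<bullet> G x \<partial>gauss)"
    using G H by (simp add: i n)
  finally have HG: "(\<integral>x. (norm (H x - G x))\<^sup>2 \<partial>gauss) = \<dots>" .
  have uu: "(\<integral>x. (u x)\<^sup>2 \<partial>gauss) = (\<integral>x. u x * u x \<partial>gauss)"
    by (simp add: power2_eq_square)
  show ?thesis
    unfolding energy_def u_def[symmetric] G_def[symmetric] HG e1 e2 sq[OF v u] sq[OF v g] sq[OF u g] uu
    using w1 w2 by (simp add: field_simps)
qed

lemma is_minimizer_res: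
  fixes g :: "real ^ 'n \<Rightarrow> real"
  assumes "square_integrable gauss g"
  shows "is_minimizer g (res g) (res_grad g)"
  unfolding is_minimizer_def
proof (intro conjI allI impI)
  show "H1_gauss (res g) (res_grad g)" by (rule H1_gauss_res[OF assms])
  fix v :: "real ^ 'n \<Rightarrow> real" and H assume "H1_gauss v H"
  from energy_eq[OF assms this] show "energy g (res g) (res_grad g) \<le> energy g v H"
    using Bochner_Integration.integral_nonneg[of gauss "\<lambda>x. (norm (H x - res_grad g x))\<^sup>2"]
      Bochner_Integration.integral_nonneg[of gauss "\<lambda>x. (v x - res g x)\<^sup>2"] by simp
qed

text \<open>By \<open>energy_eq\<close>, a competitor whose energy is no larger has distance 0 from
  \<open>res g\<close>. The \<open>L\<^sup>2\<close> distance sees functions only up to null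
  sets.\<close>

lemma is_minimizer_unique:
  assumes g: "square_integrable gauss g" and min: "is_minimizer g u G"
  shows "AE x in gauss. u x = res g x"
proof -
  have H1: "H1_gauss u G" using min by (simp add: is_minimizer_def)
  note u = H1_gauss_square_integrable(1)[OF H1]
  note s = square_integrable_diff[OF u square_integrable_res[OF g]]
  have "energy g u G \<le> energy g (res g) (res_grad g)"
    using min H1_gauss_res[OF g] by (simp add: is_minimizer_def)
  moreover have "0 \<le> (\<integral>x. (norm (G x - res_grad g x))\<^sup>2 \<partial>gauss)" "0 \<le> (\<integral>x. (u x - res g x)\<^sup>2 \<partial>gauss)"
    by simp_all
  ultimately have "(\<integral>x. (u x - res g x)\<^sup>2 \<partial>gauss) = 0"
    using energy_eq[OF g H1] by linarith
  then have "AE x in gauss. (u x - res g x)\<^sup>2 = 0"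
    using integral_nonneg_eq_0_iff_AE[OF square_integrable_real_power2[OF s]] by simp
  then show ?thesis by simp
qed

section \<open>Convexity\<close>

text \<open>The density is positive everywhere, so both measures have the same null sets, and
  translations and scalings can be treated for Lebesgue measure.\<close>

lemma AE_gauss_iff: "(AE x in gauss. P x) \<longleftrightarrow> (AE x in lborel. P x)"
  unfolding gauss_def by (subst AE_density) (auto simp: gauss_dens_pos)

lemma AE_gauss_affine:
  assumes "AE x in gauss. P x" "c \<noteq> 0"
  shows "AE x in gauss. P (t + c *\<^sub>R x :: real ^ 'n)"
proof -
  have "AE x in density (distr lborel borel (\<lambda>x :: real ^ 'n. t + c *\<^sub>R x)) (\<lambda>_. \<bar>c\<bar> ^ DIM(real ^ 'n)). P x"
    using assms(1) unfolding AE_gauss_iff by (subst (asm) lborel_affine[OF assms(2), of t])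
  then have "AE x in distr lborel borel (\<lambda>x :: real ^ 'n. t + c *\<^sub>R x). P x"
    using assms(2) by (subst (asm) AE_density) auto
  then show ?thesis
    unfolding AE_gauss_iff by (rule AE_distrD[rotated]) simp
qed

text \<open>Affinity in \<open>x\<close> at fixed noise is what lets \<open>g (mix x q)\<close>
  inherit convexity in \<open>x\<close>.\<close>

lemma mix_affine:
  assumes "a + b = 1"
  shows "mix (a *\<^sub>R x + b *\<^sub>R y) q = a *\<^sub>R mix x q + b *\<^sub>R mix y q"
proof -
  have b: "b = 1 - a" using assms by simp
  show ?thesis unfolding b by (simp add: mix_def algebra_simps)
qed

text \<open>The point \<open>mix x q\<close> is the midpoint of two generic points, which bounds \<open>g\<close> there from above, and
  also an end point of a segment whose midpoint and other end point are generic, which bounds \<open>g\<close>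
  from below.\<close>
lemma integrable_mix_convex:
  fixes g :: "real ^ 'n \<Rightarrow> real"
  assumes g: "square_integrable gauss g" and conv: "convex_on UNIV g"
  shows "integrable noise (\<lambda>q. g (mix x q))"
proof -
  note [measurable] = square_integrable_measurable[OF g]
  have mid: "g (mix ((1 / 2) *\<^sub>R a + (1 / 2) *\<^sub>R b) q) \<le> (g (mix a q) + g (mix b q)) / 2" for a b q
    using convex_onD[OF conv, of "1 / 2" "mix a q" "mix b q"] mix_affine[of "1 / 2" "1 / 2" a b q] by simp
  have I: "AE a in gauss. integrable noise (\<lambda>q. g (mix a q))"
    using AE_square_integrable_mix[OF g]
    by eventually_elim (rule square_integrable_integrable[OF finite_measure_noise])
  have generic: "AE a in gauss. integrable noise (\<lambda>q. g (mix a q)) \<and> integrable noise (\<lambda>q. g (mix (2 *\<^sub>R x + (- 1) *\<^sub>R a) q))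
      \<and> integrable noise (\<lambda>q. g (mix (- x + 2 *\<^sub>R a) q))"
    using I AE_gauss_affine[OF I, of "- 1" "2 *\<^sub>R x"] AE_gauss_affine[OF I, of 2 "- x"] by simp
  \<comment> \<open>The measure is nonzero, so a property that holds almost everywhere holds
    somewhere.\<close>
  have "ae_filter gauss \<noteq> (bot :: (real ^ 'n) filter)"
    by (simp add: ae_filter_eq_bot_iff)
  from eventually_happens'[OF this generic] obtain a where a: "integrable noise (\<lambda>q. g (mix a q))"
    "integrable noise (\<lambda>q. g (mix (2 *\<^sub>R x + (- 1) *\<^sub>R a) q))" "integrable noise (\<lambda>q. g (mix (- x + 2 *\<^sub>R a) q))"
    by blast
  \<comment> \<open>\<open>b\<close> is the reflection of \<open>a\<close> in \<open>x\<close>, and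
    \<open>c\<close> the reflection of \<open>x\<close> in \<open>a\<close>.\<close>
  define b c where "b = 2 *\<^sub>R x + (- 1) *\<^sub>R a" and "c = - x + 2 *\<^sub>R a"
  have x: "x = (1 / 2) *\<^sub>R a + (1 / 2) *\<^sub>R b" and a': "a = (1 / 2) *\<^sub>R x + (1 / 2) *\<^sub>R c"
    by (simp_all add: b_def c_def algebra_simps)
  show ?thesis
  proof (rule Bochner_Integration.integrable_bound)
    show "integrable noise (\<lambda>q. \<bar>g (mix a q)\<bar> + \<bar>g (mix b q)\<bar> + (2 * \<bar>g (mix a q)\<bar> + \<bar>g (mix c q)\<bar>))"
      using a by (simp add: b_def c_def)
    show "AE q in noise. norm (g (mix x q)) \<le>
        norm (\<bar>g (mix a q)\<bar> + \<bar>g (mix b q)\<bar> + (2 * \<bar>g (mix a q)\<bar> + \<bar>g (mix c q)\<bar>))"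
    proof (rule AE_I2)
      fix q :: "real \<times> (real ^ 'n)"
      have "g (mix x q) \<le> (g (mix a q) + g (mix b q)) / 2"
        using mid[of a b q] unfolding x[symmetric] .
      \<comment> \<open>Read as a lower bound: \<open>g (mix x q)\<close> is at least
        \<open>2 * g (mix a q) - g (mix c q)\<close>.\<close>
      moreover have "g (mix a q) \<le> (g (mix x q) + g (mix c q)) / 2"
        using mid[of x c q] unfolding a'[symmetric] .
      ultimately have "\<bar>g (mix x q)\<bar> \<le> \<bar>g (mix a q)\<bar> + \<bar>g (mix b q)\<bar> + (2 * \<bar>g (mix a q)\<bar> + \<bar>g (mix c q)\<bar>)"
        using abs_ge_self[of "g (mix a q)"] abs_ge_self[of "g (mix b q)"] abs_ge_self[of "g (mix c q)"]
          abs_ge_minus_self[of "g (mix a q)"] abs_ge_zero[of "g (mix b q)"] abs_ge_zero[of "g (mix c q)"]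
        unfolding abs_le_iff by (simp add: field_simps)
      then show "norm (g (mix x q)) \<le>
        norm (\<bar>g (mix a q)\<bar> + \<bar>g (mix b q)\<bar> + (2 * \<bar>g (mix a q)\<bar> + \<bar>g (mix c q)\<bar>))"
        by simp
    qed
  qed measurable
qed

text \<open>The convexity inequality at each value of the noise survives integration because the
  weight \<open>sin t\<close> is nonnegative between 0 and \<open>pi / 2\<close>.\<close>

lemma convex_on_res:
  fixes g :: "real ^ 'n \<Rightarrow> real"
  assumes g: "square_integrable gauss g" and conv: "convex_on UNIV g"
  shows "convex_on UNIV (res g)"
proof (rule convex_onI)
  note [measurable] = square_integrable_measurable[OF g]
  fix t :: real and x y :: "real ^ 'n" assume t: "0 < t" "t < 1"
  define s where "s q = sin (fst q)" for q :: "real \<times> (real ^ 'n)"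
  \<comment> \<open>Integrability is secured at every \<open>z\<close>: a nonintegrable integrand
    has Bochner integral 0, and the comparison of integrals could break down there.\<close>
  have i: "integrable noise (\<lambda>q. g (mix z q) * s q)" for z
  proof (rule Bochner_Integration.integrable_bound[OF integrable_mix_convex[OF g conv, of z]])
    show "AE q in noise. norm (g (mix z q) * s q) \<le> norm (g (mix z q))"
      by (auto simp: s_def abs_mult mult_left_le)
  qed (unfold s_def, measurable)
  have "res g ((1 - t) *\<^sub>R x + t *\<^sub>R y) \<le> (\<integral>q. (1 - t) * (g (mix x q) * s q) + t * (g (mix y q) * s q) \<partial>noise)"
    unfolding res_def avg_def real_scaleR_def s_def[symmetric]
  proof (rule integral_mono_AE)
    show "AE q in noise. g (mix ((1 - t) *\<^sub>R x + t *\<^sub>R y) q) * s q \<le>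
        (1 - t) * (g (mix x q) * s q) + t * (g (mix y q) * s q)"
      using AE_noise
    proof eventually_elim
      case (elim q)
      then have "0 \<le> s q" unfolding s_def by (intro sin_ge_zero) auto
      moreover have "g (mix ((1 - t) *\<^sub>R x + t *\<^sub>R y) q) \<le> (1 - t) * g (mix x q) + t * g (mix y q)"
        using convex_onD[OF conv, of t "mix x q" "mix y q"] t mix_affine[of "1 - t" t x y q] by simp
      ultimately have "g (mix ((1 - t) *\<^sub>R x + t *\<^sub>R y) q) * s q \<le> ((1 - t) * g (mix x q) + t * g (mix y q)) * s q"
        by (rule mult_right_mono[rotated])
      then show ?case by (simp add: algebra_simps)
    qed
  qed (use i in auto)
  also have "\<dots> = (1 - t) * res g x + t * res g y"
    using i by (simp add: res_def avg_def s_def)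
  finally show "res g ((1 - t) *\<^sub>R x + t *\<^sub>R y) \<le> (1 - t) * res g x + t * res g y" .
qed simp

text \<open>A minimizer is determined only up to null sets, so convexity is asserted for a
  representative of it.\<close>

theorem theorem3p8:
  fixes g :: "real ^ 'n \<Rightarrow> real"
  assumes "g \<in> borel_measurable gauss"
    and "integrable gauss (\<lambda>x. (g x)\<^sup>2)"
    and "convex_on UNIV g"
  shows "(\<exists>u G. is_minimizer g u G) \<and>
         (\<forall>u G. is_minimizer g u G \<longrightarrow>
            (\<exists>v. convex_on UNIV v \<and> (AE x in gauss. u x = v x)))"
proof -
  have g: "square_integrable gauss g"
    using assms by (simp add: square_integrable_def)
  then show ?thesis
    using is_minimizer_res is_minimizer_unique convex_on_res[OF g assms(3)] by blast
qed

end
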